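(* Let $n\geq1$, let $\mathbf{a}=(a_1,\ldots,a_{n+1})\in\mathbb{Z}^{n+1}$ with $a_1\geq a_2\geq\cdots\geq a_{n+1}$, and let $k\in\mathbb{Z}_{\geq0}$. Then \[\#\,\Pi(a_1+kn,\,a_2+k(n-1),\,\ldots,\,a_{n+1})\cap\mathbb{Z}^{n+1}=\sum_{\lambda\vdash n+1}\#\mathrm{quot}_\lambda\bigl(\Pi(\mathbf{a})\cap\mathbb{Z}^{n+1}\bigr)\cdot f_\lambda\,k^{n+1-\ell(\lambda)},\] where the $i$-th entry of the first argument is $a_i+k(n+1-i)$.
   Context: For $\mathbf{b}\in\mathbb{R}^{n+1}$, $\Pi(\mathbf{b})$ is the convex hull of all vectors obtained by permuting the entries of $\mathbf{b}$. A partition $\lambda\vdash n+1$ is a weakly decreasing sequence $\lambda_1\geq\lambda_2\geq\cdots$ of nonnegative integers summing to $n+1$; $\ell(\lambda)$ is its number of nonzero parts. $f_\lambda$ is the number of labeled forests on vertex set $\{1,\ldots,n+1\}$ whose connected component sizes, listed in decreasing order, are $\lambda$. The map $\mathrm{quot}_\lambda\colon\mathbb{R}^{n+1}\to\mathbb{R}^{\ell(\lambda)}$ sends $(b_1,\ldots,b_{n+1})$ to $\bigl(\sum_{i=1}^{\lambda_1}b_i,\ \sum_{i=\lambda_1+1}^{\lambda_1+\lambda_2}b_i,\ \ldots,\ \sum_{i=\lambda_1+\cdots+\lambda_{\ell(\lambda)-1}+1}^{n+1}b_i\bigr)$. *)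

theory Defs
  imports "HOL-Analysis.Analysis"
begin

(* \<real>^{n+1} is real^'n, where 'n is a linearly ordered finite type with n+1 elements; its
   elements, in increasing order, play the role of the indices 1, ..., n+1. *)

definition index_pos :: "'n::{finite,linorder} \<Rightarrow> nat" where
  "index_pos i = card {j. j \<le> i}"

definition permutohedron :: "real^'n \<Rightarrow> (real^'n) set" where
  "permutohedron b = convex hull {\<chi> i. b $ p i | p. p permutes UNIV}"

definition lattice_points :: "(real^'n) set \<Rightarrow> (real^'n) set" where
  "lattice_points P = {x \<in> P. \<forall>i. x $ i \<in> \<int>}"

(* A partition is represented by the list of its nonzero parts, so that its length is the number
   of nonzero parts. *)

definition is_partition :: "nat list \<Rightarrow> nat \<Rightarrow> bool" where
  "is_partition lam m \<longleftrightarrow> sorted_wrt (\<ge>) lam \<and> (\<forall>x\<in>set lam. 0 < x) \<and> sum_list lam = m"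

(* A vector in \<real>^{length lam} is represented by the list of its coordinates, because its
   dimension depends on lam. *)

definition quot :: "nat list \<Rightarrow> real^'n::{finite,linorder} \<Rightarrow> real list" where
  "quot lam b =
     map (\<lambda>r. \<Sum>i | sum_list (take r lam) < index_pos i \<and> index_pos i \<le> sum_list (take (Suc r) lam). b $ i)
         [0..<length lam]"

(* A simple graph on the vertex set V is given by its set of edges. *)

definition is_graph :: "'v set \<Rightarrow> 'v set set \<Rightarrow> bool" where
  "is_graph V E \<longleftrightarrow> E \<subseteq> {e. e \<subseteq> V \<and> card e = 2}"

definition is_cycle :: "'v set set \<Rightarrow> 'v list \<Rightarrow> bool" where
  "is_cycle E vs \<longleftrightarrow> 3 \<le> length vs \<and> distinct vs \<and>
     (\<forall>i < length vs. {vs ! i, vs ! (Suc i mod length vs)} \<in> E)"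

definition is_forest :: "'v set \<Rightarrow> 'v set set \<Rightarrow> bool" where
  "is_forest V E \<longleftrightarrow> is_graph V E \<and> (\<nexists>vs. is_cycle E vs)"

definition components :: "'v set \<Rightarrow> 'v set set \<Rightarrow> 'v set set" where
  "components V E = V // {(u, v) \<in> V \<times> V. (u, v) \<in> {(x, y). {x, y} \<in> E}\<^sup>*}"

definition component_sizes :: "'v set \<Rightarrow> 'v set set \<Rightarrow> nat list" where
  "component_sizes V E = rev (sorted_list_of_multiset (image_mset card (mset_set (components V E))))"

(* The vertex set {1..sum_list lam} is {1..n+1} when lam is a partition of n+1. *)

definition num_forests :: "nat list \<Rightarrow> nat" where
  "num_forests lam =
     card {E. is_forest {1..sum_list lam} E \<and> component_sizes {1..sum_list lam} E = lam}"

end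

(* For a submodular function f with f {} = 0, write B(f) for the integer points of its base
   polytope, i.e. x(A) <= f A for all A, with equality for the ground set.  Let g be the function
   A |-> [e meets A] of an edge e = {i, j}.  Uncrossing two tight sets shows
   B(f + g) = (B(f) + e_i) Un (B(f) + e_j); as every fibre of B(f) in direction e_i - e_j is an
   interval, each nonempty fibre gains exactly one point, so
     #B(f + g) = #B(f) + #(image of B(f) when the coordinates i and j are added up).
   The image of B(f) under adding up the coordinates in each block of a set partition is again the
   B of a submodular function, namely f restricted to unions of blocks, hence the formula can be
   iterated.  It is a deletion-contraction recurrence, which turns #B(f + k * sum of g over all
   edges) into a sum over forests.

   By Rado's theorem the integer points of the permutohedron of b are B(f) for
   f A = sum of the card A largest entries of b.  Passing from a_i to a_i + k(n+1-i) adds to this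
   f exactly k times the number of edges of the complete graph that meet A. *)

theory Submission
  imports Defs
begin

section \<open>Integer points of base polytopes\<close>

text \<open>The delicate point is integrality: every integer point of a contracted base polytope
  must come from an integer point of the original one. Splitting one merged coordinate at a time
  reduces this to choosing an integer between integer bounds. The powers of k come from loops. Once
  an edge is contracted, each further copy of it is a loop, and a loop only translates the points.
  So k parallel copies contribute k times the contracted count, not a polynomial of higher degree.
  Likewise an edge that closes a cycle with contracted edges contributes no term, which leaves
  exactly the forests. A forest with l components on n + 1 vertices has n + 1 - l edges.
  Contractions are applied to the function of \<open>a\<close>, never to the shifted one. This
  function depends only on the cardinality of its argument, so a contracted count depends only on
  the component sizes, and the components of a forest may be replaced by the consecutive blocks that
  \<open>quot\<close> uses.\<close>

definition submodular :: "'v set \<Rightarrow> ('v set \<Rightarrow> int) \<Rightarrow> bool" where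
  "submodular V f \<longleftrightarrow> f {} = 0 \<and> (\<forall>A B. A \<subseteq> V \<longrightarrow> B \<subseteq> V \<longrightarrow> f (A \<union> B) + f (A \<inter> B) \<le> f A + f B)"

(* Points are set to 0 outside V, so that they are determined by their coordinates in V. *)
definition base_points :: "'v set \<Rightarrow> ('v set \<Rightarrow> int) \<Rightarrow> ('v \<Rightarrow> int) set" where
  "base_points V f = {x. (\<forall>v. v \<notin> V \<longrightarrow> x v = 0) \<and> sum x V = f V \<and> (\<forall>A\<subseteq>V. sum x A \<le> f A)}"

text \<open>With \<open>c\<close> sending each position to the number of its block, this is the
  integer form of \<open>quot\<close>; with \<open>c\<close> merging two components, it contracts an
  edge.\<close>

definition pushforward :: "('v \<Rightarrow> 'w) \<Rightarrow> 'v set \<Rightarrow> ('v \<Rightarrow> int) \<Rightarrow> 'w \<Rightarrow> int" where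
  "pushforward c V x w = (\<Sum>v | v \<in> V \<and> c v = w. x v)"

lemma submodularD:
  "submodular V f \<Longrightarrow> A \<subseteq> V \<Longrightarrow> B \<subseteq> V \<Longrightarrow> f (A \<union> B) + f (A \<inter> B) \<le> f A + f B"
  by (auto simp: submodular_def)

lemma base_points_upper: "x \<in> base_points V f \<Longrightarrow> A \<subseteq> V \<Longrightarrow> sum x A \<le> f A"
  by (simp add: base_points_def)

lemma base_points_total: "x \<in> base_points V f \<Longrightarrow> sum x V = f V"
  by (simp add: base_points_def)

lemma base_points_outside: "x \<in> base_points V f \<Longrightarrow> v \<notin> V \<Longrightarrow> x v = 0"
  by (simp add: base_points_def)

lemma base_pointsI:
  "(\<And>A. A \<subseteq> V \<Longrightarrow> sum x A \<le> f A) \<Longrightarrow> sum x V = f V \<Longrightarrow> (\<And>v. v \<notin> V \<Longrightarrow> x v = 0)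
    \<Longrightarrow> x \<in> base_points V f"
  by (simp add: base_points_def)

lemma base_points_cong:
  assumes "\<And>A. A \<subseteq> V \<Longrightarrow> f A = g A"
  shows "base_points V f = base_points V g"
  using assms by (auto simp: base_points_def)

text \<open>The fixed total turns the upper bound on the complement of \<open>v\<close> into a lower
  bound for \<open>x v\<close>, so all coordinates lie in one finite range.\<close>

lemma finite_base_points:
  assumes "finite V"
  shows "finite (base_points V f)"
proof -
  let ?lo = "Min ((\<lambda>v. f V - f (V - {v})) ` V)" and ?hi = "Max ((\<lambda>v. f {v}) ` V)"
  have "x v \<in> {?lo..?hi}" if x: "x \<in> base_points V f" and v: "v \<in> V" for x v
  proof -
    have "x v \<le> f {v}" "sum x (V - {v}) \<le> f (V - {v})" "sum x V = f V"
      using base_points_upper[OF x, of "{v}"] base_points_upper[OF x, of "V - {v}"]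
        base_points_total[OF x] v by auto
    moreover have "sum x V = x v + sum x (V - {v})"
      using assms v by (simp add: sum.remove)
    moreover have "?lo \<le> f V - f (V - {v})" "f {v} \<le> ?hi"
      using assms v by auto
    ultimately show ?thesis by auto
  qed
  then have "base_points V f \<subseteq> {x. \<forall>v. (v \<in> V \<longrightarrow> x v \<in> {?lo..?hi}) \<and> (v \<notin> V \<longrightarrow> x v = 0)}"
    by (auto simp: base_points_def)
  then show ?thesis
    by (rule finite_subset) (intro finite_set_of_finite_funs assms finite_atLeastAtMost_int)
qed

lemma sum_pushforward:
  assumes "finite V" "finite Q"
  shows "sum (pushforward c V x) Q = (\<Sum>v | v \<in> V \<and> c v \<in> Q. x v)"
proof -
  let ?S = "{v \<in> V. c v \<in> Q}"
  have "sum x ?S = (\<Sum>w\<in>Q. \<Sum>v | v \<in> ?S \<and> c v = w. x v)"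
    using assms by (intro sum.group[symmetric]) auto
  also have "\<dots> = sum (pushforward c V x) Q"
    unfolding pushforward_def by (intro sum.cong refl arg_cong[where f = "sum x"]) auto
  finally show ?thesis by simp
qed

(* The split coordinates exist because x i only has to satisfy lower and upper bounds of the form
   x i + x j + x(B) - f (insert j B) and f (insert i A) - x(A); submodularity makes every lower bound
   at most every upper bound. *)
lemma base_points_split:
  assumes fin: "finite V" and sub: "submodular V f" and ij: "i \<in> V" "j \<in> V" "i \<noteq> j"
    and x': "x' \<in> base_points (V - {j}) (\<lambda>A. f (if i \<in> A then insert j A else A))"
  obtains x where "x \<in> base_points V f" "x' = x(i := x i + x j, j := 0)"
proof -
  define W where "W = V - {i, j}"
  define l where "l = (\<lambda>B. x' i + sum x' B - f (insert j B))"
  have finW: "finite W" using fin by (simp add: W_def)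
  \<comment> \<open>The largest lower bound is itself taken as the \<open>i\<close> coordinate. It
    is attained at some \<open>B\<close>, so the upper bounds only have to be compared with this one
    set.\<close>
  define lo where "lo = Max (l ` Pow W)"
  have lo_ge: "l B \<le> lo" if "B \<subseteq> W" for B
    using that finW by (auto simp: lo_def)
  have "lo \<in> l ` Pow W"
    unfolding lo_def using finW by (intro Max_in) auto
  then obtain B where B: "B \<subseteq> W" "lo = l B" by auto
  have x'0: "sum x' A \<le> f A" if "A \<subseteq> W" for A
    using base_points_upper[OF x', of A] that by (simp add: W_def subset_Diff_insert)
  have x'1: "x' i + sum x' A \<le> f (insert i (insert j A))" if "A \<subseteq> W" for A
  proof -
    have "sum x' (insert i A) \<le> f (insert j (insert i A))"
      using base_points_upper[OF x', of "insert i A"] that ij by (auto simp: W_def)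
    moreover have "finite A" "i \<notin> A"
      using that finite_subset[OF that finW] by (auto simp: W_def)
    ultimately show ?thesis
      by (simp add: insert_commute)
  qed
  define x where "x = x'(i := lo, j := x' i - lo)"
  have xA: "sum x A = sum x' A" if "A \<subseteq> W" for A
    using that by (intro sum.cong) (auto simp: x_def W_def)
  have upper: "sum x' A + lo \<le> f (insert i A)" if A: "A \<subseteq> W" for A
  proof -
    have "insert i A \<union> insert j B = insert i (insert j (A \<union> B))" "insert i A \<inter> insert j B = A \<inter> B"
      using A B ij by (auto simp: W_def)
    then have "f (insert i (insert j (A \<union> B))) + f (A \<inter> B) \<le> f (insert i A) + f (insert j B)"
      using submodularD[OF sub, of "insert i A" "insert j B"] A B ij by (auto simp: W_def)
    moreover have "x' i + sum x' (A \<union> B) \<le> f (insert i (insert j (A \<union> B)))"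
      using A B by (intro x'1) auto
    moreover have "sum x' (A \<inter> B) \<le> f (A \<inter> B)"
      using A by (intro x'0) auto
    moreover have "sum x' (A \<union> B) + sum x' (A \<inter> B) = sum x' A + sum x' B"
      using A B finW by (intro sum.union_inter) (auto intro: finite_subset)
    ultimately show ?thesis using B by (simp add: l_def)
  qed
  have "sum x A \<le> f A" if A: "A \<subseteq> V" for A
  proof -
    define C where "C = A - {i, j}"
    have C: "C \<subseteq> W" "i \<notin> C" "j \<notin> C" "finite C"
      using A finW finite_subset by (auto simp: C_def W_def)
    have xij: "x i = lo" "x j = x' i - lo" using ij by (auto simp: x_def)
    consider "A = C" | "A = insert i C" | "A = insert j C" | "A = insert i (insert j C)"
      unfolding C_def by fast
    then show ?thesis
    proof cases
      case 1
      then show ?thesis using xA x'0 C by simp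
    next
      case 2
      then show ?thesis using upper[of C] xA[of C] C xij by simp
    next
      case 3
      then show ?thesis using lo_ge[of C] xA[of C] C xij by (simp add: l_def)
    next
      case 4
      then show ?thesis using x'1[of C] xA[of C] C xij ij by simp
    qed
  qed
  moreover have "sum x V = f V"
  proof -
    have V: "V = insert i (insert j W)" and nW: "i \<notin> W" "j \<notin> W" using ij by (auto simp: W_def)
    have "V - {j} = insert i W" using ij by (auto simp: W_def)
    then have "x' i + sum x' W = f V"
      using base_points_total[OF x'] nW finW V by (simp add: insert_commute)
    then show ?thesis
      using xA[of W] nW finW ij by (subst V) (simp add: x_def)
  qed
  moreover have "x v = 0" if "v \<notin> V" for v
    using that base_points_outside[OF x', of v] ij by (auto simp: x_def)
  ultimately have "x \<in> base_points V f"
    by (intro base_pointsI)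
  moreover have "x' = x(i := x i + x j, j := 0)"
    using base_points_outside[OF x', of j] ij by (auto simp: x_def fun_eq_iff)
  ultimately show thesis by (rule that)
qed

text \<open>Merging two points of a fibre of \<open>c\<close> at a time reduces the reverse
  inclusion to \<open>base_points_split\<close>; once \<open>c\<close> is injective on
  \<open>V\<close>, only a relabelling remains.\<close>

lemma pushforward_base_points:
  assumes fin: "finite V" and sub: "submodular V f" and c: "c ` V = W"
  shows "pushforward c V ` base_points V f = base_points W (\<lambda>Q. f {v \<in> V. c v \<in> Q})"
proof
  have finW: "finite W" using fin c by auto
  show "pushforward c V ` base_points V f \<subseteq> base_points W (\<lambda>Q. f {v \<in> V. c v \<in> Q})"
  proof
    fix y assume "y \<in> pushforward c V ` base_points V f"
    then obtain x where x: "x \<in> base_points V f" and y: "y = pushforward c V x" by auto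
    have "sum y Q = sum x {v \<in> V. c v \<in> Q}" if "Q \<subseteq> W" for Q
      unfolding y using that finW by (intro sum_pushforward fin) (auto intro: finite_subset)
    moreover have "y w = 0" if "w \<notin> W" for w
      using that c unfolding y pushforward_def by (intro sum.neutral) auto
    moreover have "{v \<in> V. c v \<in> W} = V" using c by auto
    ultimately show "y \<in> base_points W (\<lambda>Q. f {v \<in> V. c v \<in> Q})"
      using x by (auto simp: base_points_def)
  qed
  show "base_points W (\<lambda>Q. f {v \<in> V. c v \<in> Q}) \<subseteq> pushforward c V ` base_points V f"
    using fin sub c
  proof (induction "card V" arbitrary: V f rule: less_induct)
    case less
    show ?case
    proof (cases "inj_on c V")
      case inj: True
      show ?thesis
      proof
        fix y assume y: "y \<in> base_points W (\<lambda>Q. f {v \<in> V. c v \<in> Q})"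
        define x where "x v = (if v \<in> V then y (c v) else 0)" for v
        have xA: "sum x A = sum y (c ` A)" if "A \<subseteq> V" for A
        proof -
          have "inj_on c A" using inj that by (rule inj_on_subset)
          then show ?thesis using that
            by (subst sum.reindex) (auto simp: x_def intro!: sum.cong)
        qed
        have cA: "{v \<in> V. c v \<in> c ` A} = A" if "A \<subseteq> V" for A
          using that inj by (auto simp: inj_on_def)
        have "x \<in> base_points V f"
        proof (intro base_pointsI)
          show "sum x V = f V"
            using xA[of V] cA[of V] base_points_total[OF y] less.prems by simp
          show "sum x A \<le> f A" if "A \<subseteq> V" for A
            using base_points_upper[OF y, of "c ` A"] image_mono[OF that, of c] less.prems(3) xA[OF that] cA[OF that]
            by simp
        qed (auto simp: x_def)
        moreover have "pushforward c V x = y"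
        proof
          fix w
          show "pushforward c V x w = y w"
          proof (cases "w \<in> W")
            case True
            then obtain v where v: "v \<in> V" "w = c v" using less.prems by auto
            then have "{u \<in> V. c u = w} = {v}" using inj by (auto simp: inj_on_def)
            then have "pushforward c V x w = x v" by (simp only: pushforward_def) simp
            then show ?thesis using v by (simp add: x_def)
          next
            case False
            then have "{u \<in> V. c u = w} = {}" using less.prems by auto
            then show ?thesis
              using base_points_outside[OF y False] by (simp only: pushforward_def sum.empty)
          qed
        qed
        ultimately show "y \<in> pushforward c V ` base_points V f" by auto
      qed
    next
      case False
      then obtain i j where ij: "i \<in> V" "j \<in> V" "c i = c j" "i \<noteq> j" by (auto simp: inj_on_def)
      \<comment> \<open>\<open>f\<close> after \<open>j\<close> has been merged into
        \<open>i\<close>, which now stands for both.\<close>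
      define f' where "f' = (\<lambda>A. f (if i \<in> A then insert j A else A))"
      have "submodular (V - {j}) f'"
        unfolding submodular_def
      proof (intro conjI allI impI)
        show "f' {} = 0" using less.prems by (auto simp: f'_def submodular_def)
        fix A B assume AB: "A \<subseteq> V - {j}" "B \<subseteq> V - {j}"
        let ?e = "\<lambda>A. if i \<in> A then insert j A else A"
        have "?e A \<union> ?e B = ?e (A \<union> B)" "?e A \<inter> ?e B = ?e (A \<inter> B)" "?e A \<subseteq> V" "?e B \<subseteq> V"
          using AB ij by auto
        then show "f' (A \<union> B) + f' (A \<inter> B) \<le> f' A + f' B"
          using submodularD[OF less.prems(2), of "?e A" "?e B"] by (simp only: f'_def)
      qed
      moreover have "c ` (V - {j}) = W"
      proof -
        have "c ` V = insert (c j) (c ` (V - {j}))" using ij by (metis image_insert insert_Diff)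
        moreover have "c j \<in> c ` (V - {j})" using ij by (intro image_eqI[of _ _ i]) auto
        ultimately show ?thesis using less.prems by auto
      qed
      moreover have "card (V - {j}) < card V" using less.prems ij by (intro card_Diff1_less) auto
      moreover have "finite (V - {j})" using less.prems by auto
      ultimately have IH: "base_points W (\<lambda>Q. f' {v \<in> V - {j}. c v \<in> Q})
          \<subseteq> pushforward c (V - {j}) ` base_points (V - {j}) f'"
        by (intro less.hyps)
      \<comment> \<open>Since \<open>c i = c j\<close>, a preimage under \<open>c\<close> contains
        both of \<open>i\<close> and \<open>j\<close> or neither, so merging them keeps its
        value.\<close>
      have "f' {v \<in> V - {j}. c v \<in> Q} = f {v \<in> V. c v \<in> Q}" for Q
        using ij unfolding f'_def by (intro arg_cong[where f = f]) auto
      note IH = IH[unfolded this]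
      show ?thesis
      proof
        fix y assume "y \<in> base_points W (\<lambda>Q. f {v \<in> V. c v \<in> Q})"
        then obtain x' where x': "x' \<in> base_points (V - {j}) f'" and y: "y = pushforward c (V - {j}) x'"
          using IH by auto
        obtain x where x: "x \<in> base_points V f" "x' = x(i := x i + x j, j := 0)"
          using base_points_split[OF less.prems(1,2) ij(1,2,4) x'[unfolded f'_def]] .
        have "pushforward c V x w = y w" for w
        proof (cases "w = c i")
          case True
          note w = True
          define U where "U = {v \<in> V. c v = w} - {i, j}"
          have U: "{v \<in> V. c v = w} = insert i (insert j U)" "{v \<in> V - {j}. c v = w} = insert i U"
            "finite U" "i \<notin> U" "j \<notin> U"
            using True ij less.prems by (auto simp: U_def)
          have "sum x' U = sum x U" using U by (intro sum.cong) (auto simp: x)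
          then show ?thesis using U ij(4) by (simp add: y pushforward_def x(2))
        next
          case False
          then have "{v \<in> V. c v = w} = {v \<in> V - {j}. c v = w}" using ij by auto
          then have "pushforward c V x w = sum x {v \<in> V - {j}. c v = w}"
            by (simp only: pushforward_def)
          also have "\<dots> = y w"
            unfolding y pushforward_def using False by (intro sum.cong) (auto simp: x(2))
          finally show ?thesis .
        qed
        then show "y \<in> pushforward c V ` base_points V f"
          using x(1) by (intro image_eqI[of _ _ x]) auto
      qed
    qed
  qed
qed

section \<open>Adding an edge to a submodular function\<close>

text \<open>For a nonempty finite \<open>e\<close> inside the ground set, the base points of this
  function are the unit vectors of the elements of \<open>e\<close>. A singleton \<open>e\<close> is
  a loop, which arises when both ends of an edge lie in one block.\<close>

definition meets :: "'v set \<Rightarrow> 'v set \<Rightarrow> int" where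
  "meets e A = of_bool (e \<inter> A \<noteq> {})"

lemma submodular_meets: "submodular V (meets e)"
  by (auto simp: submodular_def meets_def)

lemma submodular_add:
  "submodular V f \<Longrightarrow> submodular V g \<Longrightarrow> submodular V (\<lambda>A. f A + g A)"
  unfolding submodular_def
proof safe
  fix A B assume *: "\<forall>A B. A \<subseteq> V \<longrightarrow> B \<subseteq> V \<longrightarrow> f (A \<union> B) + f (A \<inter> B) \<le> f A + f B"
    "\<forall>A B. A \<subseteq> V \<longrightarrow> B \<subseteq> V \<longrightarrow> g (A \<union> B) + g (A \<inter> B) \<le> g A + g B" "A \<subseteq> V" "B \<subseteq> V"
  show "f (A \<union> B) + g (A \<union> B) + (f (A \<inter> B) + g (A \<inter> B)) \<le> f A + g A + (f B + g B)"
    using *(1)[rule_format, OF *(3,4)] *(2)[rule_format, OF *(3,4)] by linarith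
qed simp

lemma submodular_scale:
  "submodular V f \<Longrightarrow> c \<ge> 0 \<Longrightarrow> submodular V (\<lambda>A. c * f A)"
  by (auto simp: submodular_def distrib_left[symmetric] intro!: mult_left_mono)

lemma submodular_sum:
  "(\<And>e. e \<in> E \<Longrightarrow> submodular V (f e)) \<Longrightarrow> submodular V (\<lambda>A. \<Sum>e\<in>E. f e A)"
  unfolding submodular_def
  by (auto simp: sum.distrib[symmetric] intro!: sum_mono)

lemma sum_add_unit:
  fixes x :: "'v \<Rightarrow> int"
  assumes "finite A"
  shows "(\<Sum>v\<in>A. x v + of_bool (v = i)) = sum x A + of_bool (i \<in> A)"
  using assms by (simp add: sum.distrib of_bool_def)

text \<open>A loop raises the bound of exactly the sets containing \<open>i\<close>, and with them
  the total, so it translates all points by one unit vector.\<close>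

lemma base_points_add_loop:
  assumes fin: "finite V" and i: "i \<in> V"
  shows "base_points V (\<lambda>A. f A + meets {i} A) = (\<lambda>x v. x v + of_bool (v = i)) ` base_points V f"
proof -
  have shift: "(\<lambda>v. x v + of_bool (v = i)) \<in> base_points V (\<lambda>A. f A + meets {i} A) \<longleftrightarrow> x \<in> base_points V f"
    for x :: "'a \<Rightarrow> int"
  proof -
    have "(\<Sum>v\<in>A. x v + of_bool (v = i)) = sum x A + meets {i} A" if "A \<subseteq> V" for A
      using sum_add_unit[of A x i] finite_subset[OF that fin] by (simp add: meets_def)
    moreover have "(\<forall>v. v \<notin> V \<longrightarrow> x v + of_bool (v = i) = 0) \<longleftrightarrow> (\<forall>v. v \<notin> V \<longrightarrow> x v = 0)"
      using i by (metis add.right_neutral of_bool_eq(1))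
    ultimately show ?thesis
      by (simp add: base_points_def)
  qed
  show ?thesis
  proof (intro set_eqI iffI)
    fix y assume "y \<in> base_points V (\<lambda>A. f A + meets {i} A)"
    then show "y \<in> (\<lambda>x v. x v + of_bool (v = i)) ` base_points V f"
      using shift[of "\<lambda>v. y v - of_bool (v = i)"]
      by (intro image_eqI[of _ _ "\<lambda>v. y v - of_bool (v = i)"]) auto
  qed (use shift in auto)
qed

lemma card_base_points_add_loop:
  assumes "finite V" "i \<in> V"
  shows "card (base_points V (\<lambda>A. f A + meets {i} A)) = card (base_points V f)"
  unfolding base_points_add_loop[OF assms]
  by (intro card_image inj_onI) (simp add: fun_eq_iff)

(* If y - e_i and y - e_j both left B(f), there would be sets A (with j, without i) and B (with i,
   without j) on which y exceeds f by 1; submodularity of f then contradicts the bounds for y on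
   A Un B and A Int B. *)
lemma base_points_add_edge:
  assumes fin: "finite V" and sub: "submodular V f" and ij: "i \<in> V" "j \<in> V" "i \<noteq> j"
  shows "base_points V (\<lambda>A. f A + meets {i, j} A)
    = (\<lambda>x v. x v + of_bool (v = i)) ` base_points V f \<union> (\<lambda>x v. x v + of_bool (v = j)) ` base_points V f"
proof (intro equalityI subsetI)
  fix y assume "y \<in> (\<lambda>x v. x v + of_bool (v = i)) ` base_points V f \<union> (\<lambda>x v. x v + of_bool (v = j)) ` base_points V f"
  then obtain x l where x: "x \<in> base_points V f" and l: "l \<in> {i, j}" and y: "y = (\<lambda>v. x v + of_bool (v = l))"
    by auto
  show "y \<in> base_points V (\<lambda>A. f A + meets {i, j} A)"
  proof (rule base_pointsI)
    show "sum y A \<le> f A + meets {i, j} A" if "A \<subseteq> V" for A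
      using base_points_upper[OF x that] l sum_add_unit[OF finite_subset[OF that fin], of x l]
      by (auto simp: y meets_def)
    show "sum y V = f V + meets {i, j} V"
      using base_points_total[OF x] l ij sum_add_unit[OF fin, of x l]
      by (auto simp: y meets_def)
    show "y v = 0" if "v \<notin> V" for v
      using base_points_outside[OF x that] that l ij by (auto simp: y)
  qed
next
  fix y assume y: "y \<in> base_points V (\<lambda>A. f A + meets {i, j} A)"
  have *: "y \<in> (\<lambda>x v. x v + of_bool (v = l)) ` base_points V f \<or>
      (\<exists>A\<subseteq>V. l \<notin> A \<and> m \<in> A \<and> sum y A = f A + 1)" if lm: "{l, m} = {i, j}" "l \<noteq> m" for l m
  proof (rule disjCI)
    assume no: "\<not> (\<exists>A\<subseteq>V. l \<notin> A \<and> m \<in> A \<and> sum y A = f A + 1)"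
    define x where "x v = y v - of_bool (v = l)" for v
    have lV: "l \<in> V" using lm ij by auto
    have xA: "sum x A = sum y A - of_bool (l \<in> A)" if "A \<subseteq> V" for A
      using sum_add_unit[OF finite_subset[OF that fin], of x l] by (simp add: x_def)
    have "x \<in> base_points V f"
    proof (rule base_pointsI)
      show "sum x V = f V"
        using xA[of V] base_points_total[OF y] lV ij by (simp add: meets_def)
      show "x v = 0" if "v \<notin> V" for v
        using base_points_outside[OF y that] that lV by (auto simp: x_def)
      show "sum x A \<le> f A" if A: "A \<subseteq> V" for A
      proof (cases "l \<in> A")
        case True
        moreover have "meets {i, j} A \<le> 1" by (simp add: meets_def)
        ultimately show ?thesis using xA[OF A] base_points_upper[OF y A] by simp
      next
        case False
        then have "meets {l, m} A = of_bool (m \<in> A)" by (auto simp: meets_def)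
        then have "sum y A \<le> f A + of_bool (m \<in> A)"
          using base_points_upper[OF y A] lm by simp
        then show ?thesis using no A False xA[OF A] by (cases "m \<in> A") force+
      qed
    qed
    then show "y \<in> (\<lambda>x v. x v + of_bool (v = l)) ` base_points V f"
      by (intro image_eqI[of _ _ x]) (auto simp: x_def)
  qed
  show "y \<in> (\<lambda>x v. x v + of_bool (v = i)) ` base_points V f \<union> (\<lambda>x v. x v + of_bool (v = j)) ` base_points V f"
  proof (rule ccontr)
    assume no: "\<not> ?thesis"
    obtain A where A: "A \<subseteq> V" "i \<notin> A" "j \<in> A" "sum y A = f A + 1"
      using *[of i j] ij no by auto
    obtain B where B: "B \<subseteq> V" "j \<notin> B" "i \<in> B" "sum y B = f B + 1"
      using *[of j i] ij no by auto
    have "sum y (A \<union> B) + sum y (A \<inter> B) = sum y A + sum y B"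
      using A B fin by (intro sum.union_inter) (auto intro: finite_subset)
    \<comment> \<open>The union contains both ends and the intersection neither, so
      \<open>meets\<close> allows an excess of 1 in all, against the total excess of 2 on
      \<open>A\<close> and \<open>B\<close>.\<close>
    moreover have "sum y (A \<union> B) \<le> f (A \<union> B) + 1" "sum y (A \<inter> B) \<le> f (A \<inter> B)"
      using base_points_upper[OF y, of "A \<union> B"] base_points_upper[OF y, of "A \<inter> B"] A B
      by (auto simp: meets_def split: if_splits)
    ultimately show False
      using submodularD[OF sub A(1) B(1)] A B by linarith
  qed
qed

text \<open>\<open>T\<close> consists of the last point of each fibre in direction \<open>d\<close>,
  so it has one point for each image under \<open>pushforward\<close>. Its \<open>?J\<close>
  translates are exactly the points of the union that are not \<open>?I\<close> translates. By
  \<open>c_inj\<close> the map \<open>c\<close> identifies nothing beyond \<open>i\<close> and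
  \<open>j\<close>.\<close>

lemma card_base_points_add_edge:
  assumes fin: "finite V" and sub: "submodular V f" and ij: "i \<in> V" "j \<in> V" "i \<noteq> j"
    and c: "c i = c j" and c_inj: "\<And>u v. u \<in> V \<Longrightarrow> v \<in> V \<Longrightarrow> c u = c v \<Longrightarrow> u = v \<or> {u, v} = {i, j}"
  shows "card (base_points V (\<lambda>A. f A + meets {i, j} A))
    = card (base_points V f) + card (pushforward c V ` base_points V f)"
proof -
  let ?S = "base_points V f"
  define d where "d v = of_bool (v = j) - (of_bool (v = i) :: int)" for v
  define T where "T = {x \<in> ?S. (\<lambda>v. x v + d v) \<notin> ?S}"
  let ?I = "\<lambda>x v. x v + (of_bool (v = i) :: int)" and ?J = "\<lambda>x v. x v + (of_bool (v = j) :: int)"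
  have finS: "finite ?S" using fin by (rule finite_base_points)
  have fibre: "pushforward c V x = pushforward c V y \<longleftrightarrow> (\<exists>t. y = (\<lambda>v. x v + t * d v))"
    if x: "x \<in> ?S" and y: "y \<in> ?S" for x y
  proof
    assume eq: "pushforward c V x = pushforward c V y"
    have other: "x v = y v" if v: "v \<in> V" "v \<noteq> i" "v \<noteq> j" for v
    proof -
      have "{u \<in> V. c u = c v} = {v}" using c_inj v by auto
      then show ?thesis using fun_cong[OF eq, of "c v"] by (simp only: pushforward_def) simp
    qed
    have "{u \<in> V. c u = c i} = {i, j}" using c_inj[of _ i] ij c by auto
    then have "x i + x j = y i + y j"
      using fun_cong[OF eq, of "c i"] ij by (simp only: pushforward_def) simp
    then have "y = (\<lambda>v. x v + (y j - x j) * d v)"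
      using other base_points_outside[OF x] base_points_outside[OF y] ij(3)
      by (intro ext, rename_tac v, case_tac "v \<in> V") (auto simp: d_def)
    then show "\<exists>t. y = (\<lambda>v. x v + t * d v)" by blast
  next
    assume "\<exists>t. y = (\<lambda>v. x v + t * d v)"
    then obtain t where t: "y = (\<lambda>v. x v + t * d v)" by blast
    have "sum d {v \<in> V. c v = w} = 0" for w
      using fin ij c by (simp add: d_def sum_subtractf of_bool_def)
    then show "pushforward c V x = pushforward c V y"
      by (simp add: fun_eq_iff pushforward_def t sum.distrib sum_distrib_left[symmetric])
  qed
  \<comment> \<open>Along \<open>d\<close> the sum over a set has slope -1, 0 or 1, so a bound valid
    at 0 and at \<open>t\<close> is valid at 1.\<close>
  have convex: "(\<lambda>v. x v + d v) \<in> ?S" if x: "x \<in> ?S" and t: "(\<lambda>v. x v + t * d v) \<in> ?S" "t \<ge> 1" for x t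
  proof (rule base_pointsI)
    have dA: "(\<Sum>v\<in>A. x v + s * d v) = sum x A + s * (of_bool (j \<in> A) - of_bool (i \<in> A))" if "A \<subseteq> V" for A s
      using finite_subset[OF that fin]
      by (simp add: d_def sum.distrib sum_distrib_left[symmetric] sum_subtractf of_bool_def)
    show "sum (\<lambda>v. x v + d v) V = f V"
      using dA[of V 1] ij base_points_total[OF x] by simp
    show "x v + d v = 0" if "v \<notin> V" for v
      using base_points_outside[OF x that] that ij by (auto simp: d_def)
    show "sum (\<lambda>v. x v + d v) A \<le> f A" if "A \<subseteq> V" for A
      using dA[OF that, of 1] dA[OF that, of t] base_points_upper[OF x that]
        base_points_upper[OF t(1) that] t(2) by (auto simp: of_bool_def split: if_splits)
  qed
  have "inj_on (pushforward c V) T"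
  proof (rule inj_onI)
    fix x y assume xy: "x \<in> T" "y \<in> T" "pushforward c V x = pushforward c V y"
    then obtain t where t: "y = (\<lambda>v. x v + t * d v)" using fibre by (auto simp: T_def)
    then have "x = (\<lambda>v. y v + (- t) * d v)" by auto
    \<comment> \<open>If the points differed, the one with the smaller \<open>j\<close> entry would
      have its successor in \<open>?S\<close>, against its membership in \<open>T\<close>.\<close>
    then have "\<not> t \<ge> 1" "\<not> - t \<ge> 1"
      using convex[of x t] convex[of y "- t"] xy t by (auto simp: T_def)
    then have "t = 0" by linarith
    then show "x = y" using t by simp
  qed
  moreover have "pushforward c V ` T = pushforward c V ` ?S"
  proof
    show "pushforward c V ` ?S \<subseteq> pushforward c V ` T"
    proof
      fix w assume "w \<in> pushforward c V ` ?S"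
      then obtain x where x: "x \<in> ?S" "w = pushforward c V x" by auto
      define Y where "Y = {y \<in> ?S. pushforward c V y = w}"
      have Y: "finite Y" "Y \<noteq> {}" using finS x by (auto simp: Y_def)
      \<comment> \<open>Moving by \<open>d\<close> raises the \<open>j\<close> entry by 1, so a
        point of the finite fibre with the largest \<open>j\<close> entry lies in
        \<open>T\<close>.\<close>
      define m where "m = Max ((\<lambda>y. y j) ` Y)"
      have "m \<in> (\<lambda>y. y j) ` Y" unfolding m_def using Y by (intro Max_in) auto
      then obtain y where y: "y \<in> Y" "m = y j" by auto
      have "(\<lambda>v. y v + d v) \<notin> Y"
      proof
        assume "(\<lambda>v. y v + d v) \<in> Y"
        then have "y j + d j \<le> m" unfolding m_def using Y by (intro Max_ge) auto
        then show False using y ij by (simp add: d_def)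
      qed
      moreover have "pushforward c V (\<lambda>v. y v + d v) = w" if "(\<lambda>v. y v + d v) \<in> ?S"
      proof -
        have "pushforward c V y = pushforward c V (\<lambda>v. y v + d v)"
          using y that by (subst fibre) (auto simp: Y_def intro: exI[of _ 1])
        then show ?thesis using y by (simp add: Y_def)
      qed
      ultimately have "y \<in> T" using y by (auto simp: T_def Y_def)
      then show "w \<in> pushforward c V ` T" using y by (auto simp: Y_def)
    qed
  qed (auto simp: T_def)
  ultimately have cardT: "card T = card (pushforward c V ` ?S)"
    using card_image[of "pushforward c V" T] by simp
  have "?J ` ?S - ?I ` ?S = ?J ` T"
  proof -
    have "?J x \<in> ?I ` ?S \<longleftrightarrow> (\<lambda>v. x v + d v) \<in> ?S" for x
    proof
      assume "?J x \<in> ?I ` ?S"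
      then obtain z where z: "z \<in> ?S" "?J x = ?I z" by auto
      have "z = (\<lambda>v. x v + d v)"
        using fun_cong[OF z(2)] by (intro ext) (simp add: d_def algebra_simps)
      then show "(\<lambda>v. x v + d v) \<in> ?S" using z by simp
    next
      assume "(\<lambda>v. x v + d v) \<in> ?S"
      then show "?J x \<in> ?I ` ?S"
        by (intro image_eqI[of _ _ "\<lambda>v. x v + d v"]) (auto simp: d_def)
    qed
    then show ?thesis by (auto simp: T_def)
  qed
  moreover have "?I ` ?S \<union> ?J ` ?S = ?I ` ?S \<union> (?J ` ?S - ?I ` ?S)" by blast
  ultimately have "base_points V (\<lambda>A. f A + meets {i, j} A) = ?I ` ?S \<union> ?J ` T"
    and "?I ` ?S \<inter> ?J ` T = {}"
    using base_points_add_edge[OF fin sub ij] by (simp, blast)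
  moreover have "card (?I ` ?S) = card ?S" "card (?J ` T) = card T"
    by (intro card_image inj_onI; simp add: fun_eq_iff)+
  moreover have "finite T" using finS by (simp add: T_def)
  ultimately show ?thesis
    using finS cardT by (simp add: card_Un_disjoint)
qed

section \<open>Components and forests\<close>

definition connectivity :: "'v set \<Rightarrow> 'v set set \<Rightarrow> ('v \<times> 'v) set" where
  "connectivity V E = {(u, v) \<in> V \<times> V. (u, v) \<in> {(x, y). {x, y} \<in> E}\<^sup>*}"

lemma components_eq: "components V E = V // connectivity V E"
  by (simp add: components_def connectivity_def)

lemma equiv_connectivity: "equiv V (connectivity V E)"
proof (rule equivI)
  have "sym ({(x, y). {x, y} \<in> E}\<^sup>*)"
    by (intro sym_rtrancl symI) (auto simp: insert_commute)
  then show "sym (connectivity V E)"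
    by (auto simp: connectivity_def sym_def)
  show "trans (connectivity V E)"
    by (auto simp: connectivity_def trans_def)
qed (auto simp: connectivity_def refl_on_def)

lemma connectivity_insert:
  assumes uv: "u \<in> V" "v \<in> V"
  shows "connectivity V (insert {u, v} E) = connectivity V E \<union>
    (connectivity V E `` {u, v}) \<times> (connectivity V E `` {u, v})"
proof -
  define S where "S = {(x, y). {x, y} \<in> E}"
  have sym: "(x, y) \<in> S\<^sup>* \<longleftrightarrow> (y, x) \<in> S\<^sup>*" for x y
  proof -
    have "sym (S\<^sup>*)" unfolding S_def
      by (intro sym_rtrancl symI) (auto simp: insert_commute)
    then show ?thesis by (auto simp: sym_def)
  qed
  \<comment> \<open>An undirected edge contributes two ordered pairs; \<open>T\<close> is the
    closure after the first of them, so \<open>rtrancl_insert\<close> is used twice.\<close>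
  define T where "T = (insert (v, u) S)\<^sup>*"
  have step: "{(x, y). {x, y} \<in> insert {u, v} E} = insert (u, v) (insert (v, u) S)"
    by (auto simp: S_def doubleton_eq_iff insert_commute)
  have T: "(x, y) \<in> T \<longleftrightarrow> (x, y) \<in> S\<^sup>* \<or> (x, v) \<in> S\<^sup>* \<and> (u, y) \<in> S\<^sup>*" for x y
    by (simp add: T_def rtrancl_insert)
  have "(x, y) \<in> (insert (u, v) (insert (v, u) S))\<^sup>* \<longleftrightarrow>
      (x, y) \<in> S\<^sup>* \<or> ((u, x) \<in> S\<^sup>* \<or> (v, x) \<in> S\<^sup>*) \<and> ((u, y) \<in> S\<^sup>* \<or> (v, y) \<in> S\<^sup>*)" for x y
    unfolding rtrancl_insert[of u v] T_def[symmetric] using T sym rtrancl_trans[of _ _ S]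
    by (auto; blast)
  then show ?thesis
    using uv unfolding connectivity_def step S_def[symmetric] by auto
qed

text \<open>The new components are written as an image of the old ones because this merging map
  later serves as the \<open>c\<close> of \<open>pushforward\<close>. If both ends lie in one
  component, it fixes every component.\<close>

lemma components_insert:
  assumes uv: "u \<in> V" "v \<in> V"
  shows "components V (insert {u, v} E) =
    (\<lambda>B. if u \<in> B \<or> v \<in> B then connectivity V E `` {u, v} else B) ` components V E"
proof -
  let ?R = "connectivity V E"
  note eq = equiv_connectivity[of V E]
  have sym: "(x, y) \<in> ?R \<longleftrightarrow> (y, x) \<in> ?R" for x y
    using eq by (auto simp: equiv_def sym_def)
  have tr: "(x, y) \<in> ?R \<Longrightarrow> (y, z) \<in> ?R \<Longrightarrow> (x, z) \<in> ?R" for x y z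
    using eq by (auto simp: equiv_def trans_def)
  have "connectivity V (insert {u, v} E) `` {x} =
      (if u \<in> ?R `` {x} \<or> v \<in> ?R `` {x} then ?R `` {u, v} else ?R `` {x})" for x
  proof (rule set_eqI)
    fix y
    show "y \<in> connectivity V (insert {u, v} E) `` {x} \<longleftrightarrow>
      y \<in> (if u \<in> ?R `` {x} \<or> v \<in> ?R `` {x} then ?R `` {u, v} else ?R `` {x})"
      unfolding connectivity_insert[OF uv]
      using sym[of x u] sym[of x v] tr[of u x y] tr[of v x y] by auto
  qed
  then show ?thesis
    unfolding components_eq quotient_def UNION_singleton_eq_range image_image by (simp only:)
qed

lemma component_unique:
  assumes "B \<in> components V E" "v \<in> B"
  shows "B = connectivity V E `` {v}"
proof -
  obtain x where "x \<in> V" "B = connectivity V E `` {x}"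
    using assms(1) by (auto simp: components_eq quotient_def)
  then show ?thesis
    using assms(2) equiv_class_eq[OF equiv_connectivity, of x v V E] by auto
qed

lemma component_of: "v \<in> V \<Longrightarrow> connectivity V E `` {v} \<in> components V E"
  by (auto simp: components_eq quotientI)

lemma component_self: "v \<in> V \<Longrightarrow> v \<in> connectivity V E `` {v}"
  by (rule equiv_class_self[OF equiv_connectivity])

lemma Union_components: "\<Union> (components V E) = V"
  unfolding components_eq by (rule Union_quotient[OF equiv_connectivity])

lemma components_subset: "B \<in> components V E \<Longrightarrow> B \<subseteq> V"
  by (metis Union_components Union_upper)

lemma components_disjoint: "B \<in> components V E \<Longrightarrow> C \<in> components V E \<Longrightarrow> v \<in> B \<Longrightarrow> v \<in> C \<Longrightarrow> B = C"
  by (rule trans[OF component_unique component_unique[symmetric]])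

lemma finite_components: "finite V \<Longrightarrow> finite (components V E)"
  by (intro finite_UnionD) (simp add: Union_components)

lemma components_nonempty: "{} \<notin> components V E"
  unfolding components_eq using equiv_connectivity[of V E] in_quotient_imp_non_empty by metis

section \<open>Paths, cycles and the number of components of a forest\<close>

lemma distinct_path:
  assumes "(x, y) \<in> S\<^sup>*"
  obtains vs where "vs \<noteq> []" "hd vs = x" "last vs = y" "distinct vs"
    "\<And>i. Suc i < length vs \<Longrightarrow> (vs ! i, vs ! Suc i) \<in> S"
proof -
  have "\<exists>vs. vs \<noteq> [] \<and> hd vs = x \<and> last vs = y \<and> distinct vs \<and>
      (\<forall>i. Suc i < length vs \<longrightarrow> (vs ! i, vs ! Suc i) \<in> S)"
    using assms
  proof (induction rule: rtrancl_induct)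
    case base
    then show ?case by (intro exI[of _ "[x]"]) auto
  next
    case (step y z)
    then obtain vs where vs: "vs \<noteq> []" "hd vs = x" "last vs = y" "distinct vs"
      "\<forall>i. Suc i < length vs \<longrightarrow> (vs ! i, vs ! Suc i) \<in> S" by blast
    show ?case
    proof (cases "z \<in> set vs")
      case True
      \<comment> \<open>A path that returns to one of its vertices is cut back to that vertex, which
        keeps the vertices distinct.\<close>
      then obtain i where i: "i < length vs" "vs ! i = z" by (auto simp: in_set_conv_nth)
      have "last (take (Suc i) vs) = z"
        using i by (simp add: take_Suc_conv_app_nth)
      then show ?thesis
        using vs by (intro exI[of _ "take (Suc i) vs"]) auto
    next
      case False
      have "(vs @ [z]) ! i = y" if "Suc i = length vs" for i
      proof -
        have "i = length vs - 1" using that by simp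
        then show ?thesis using that vs by (simp add: nth_append last_conv_nth)
      qed
      then show ?thesis
        using vs False step.hyps
        by (intro exI[of _ "vs @ [z]"]) (auto simp: nth_append less_Suc_eq)
    qed
  qed
  then show thesis using that by blast
qed

text \<open>A path from \<open>u\<close> to \<open>v\<close> without repetitions closes up with the
  new edge to a cycle. Conversely, a cycle that is absent from \<open>E\<close> runs through the new
  edge, and its other edges join \<open>u\<close> and \<open>v\<close> inside
  \<open>E\<close>.\<close>

lemma forest_insert:
  assumes uv: "u \<in> V" "v \<in> V" "u \<noteq> v" "{u, v} \<notin> E"
  shows "is_forest V (insert {u, v} E) \<longleftrightarrow> is_forest V E \<and> (u, v) \<notin> connectivity V E"
proof (intro iffI conjI)
  assume forest: "is_forest V (insert {u, v} E)"
  then show "is_forest V E"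
    by (auto simp: is_forest_def is_graph_def is_cycle_def)
  show "(u, v) \<notin> connectivity V E"
  proof
    assume "(u, v) \<in> connectivity V E"
    then have "(u, v) \<in> {(x, y). {x, y} \<in> E}\<^sup>*" by (simp add: connectivity_def)
    then obtain vs where vs: "vs \<noteq> []" "hd vs = u" "last vs = v" "distinct vs"
      and path: "\<And>i. Suc i < length vs \<Longrightarrow> (vs ! i, vs ! Suc i) \<in> {(x, y). {x, y} \<in> E}"
      by (rule distinct_path) blast
    have hl: "vs ! 0 = u" "vs ! (length vs - 1) = v"
      using vs by (simp_all add: hd_conv_nth last_conv_nth)
    \<comment> \<open>Length 1 would mean \<open>u = v\<close>, and length 2 that the edge is
      already in \<open>E\<close>.\<close>
    have "length vs \<noteq> 0" "length vs \<noteq> 1" "length vs \<noteq> 2"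
      using vs(1) hl uv path[of 0] by auto
    then have "3 \<le> length vs" by linarith
    moreover have "{vs ! i, vs ! (Suc i mod length vs)} \<in> insert {u, v} E" if "i < length vs" for i
    proof (cases "Suc i = length vs")
      case True
      then have "i = length vs - 1" by simp
      then show ?thesis using True hl by (simp add: insert_commute)
    next
      case False
      then show ?thesis using path[of i] that by simp
    qed
    ultimately have "is_cycle (insert {u, v} E) vs"
      using vs by (auto simp: is_cycle_def)
    then show False using forest by (auto simp: is_forest_def)
  qed
next
  assume *: "is_forest V E \<and> (u, v) \<notin> connectivity V E"
  have "\<not> is_cycle (insert {u, v} E) vs" for vs
  proof
    assume cyc: "is_cycle (insert {u, v} E) vs"
    define n where "n = length vs"
    have n: "3 \<le> n" and dist: "distinct vs"
      and edge: "\<And>i. i < n \<Longrightarrow> {vs ! i, vs ! (Suc i mod n)} \<in> insert {u, v} E"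
      using cyc by (auto simp: is_cycle_def n_def)
    have "\<not> is_cycle E vs" using * by (auto simp: is_forest_def)
    then obtain i where i: "i < n" "{vs ! i, vs ! (Suc i mod n)} \<notin> E"
      using n dist by (auto simp: is_cycle_def n_def)
    then have e: "{vs ! i, vs ! (Suc i mod n)} = {u, v}" using edge by blast
    have nth_inj: "vs ! (a mod n) = vs ! (b mod n) \<longleftrightarrow> a mod n = b mod n" for a b
      using dist n by (intro nth_eq_iff_index_eq) (simp_all add: n_def[symmetric])
    \<comment> \<open>\<open>m\<close> counts the steps from \<open>i\<close> around the cycle:
      \<open>m = 1\<close> is the far end of the new edge, and at \<open>m = n\<close> the walk is
      back at \<open>i\<close>.\<close>
    have "(vs ! (Suc i mod n), vs ! ((i + m) mod n)) \<in> {(x, y). {x, y} \<in> E}\<^sup>*"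
      if "1 \<le> m" "m \<le> n" for m
      using that
    proof (induction m rule: nat_induct_at_least)
      case base
      then show ?case by simp
    next
      case (Suc m)
      have "{vs ! ((i + m) mod n), vs ! (Suc (i + m) mod n)} \<in> insert {u, v} E"
        using edge[of "(i + m) mod n"] n by (simp add: mod_Suc_eq)
      \<comment> \<open>The new edge does not recur for \<open>1 \<le> m < n\<close>: equal pairs of
        ends force \<open>n\<close> to divide \<open>m\<close>, or both \<open>m - 1\<close> and
        \<open>m + 1\<close> and hence 2. This is where cycles have to have length at least
        3.\<close>
      moreover have "{vs ! ((i + m) mod n), vs ! (Suc (i + m) mod n)} \<noteq> {u, v}"
      proof
        assume "{vs ! ((i + m) mod n), vs ! (Suc (i + m) mod n)} = {u, v}"
        then have "{vs ! ((i + m) mod n), vs ! (Suc (i + m) mod n)} = {vs ! (i mod n), vs ! (Suc i mod n)}"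
          using e i by simp
        then have "(i + m) mod n = i mod n \<or> (i + m) mod n = Suc i mod n \<and> Suc (i + m) mod n = i mod n"
          by (auto simp: doubleton_eq_iff nth_inj)
        moreover have "\<not> n dvd m" using Suc by (auto dest: dvd_imp_le)
        moreover have "(i + m) mod n = i mod n \<longleftrightarrow> n dvd m"
          using mod_eq_dvd_iff_nat[of i "i + m" n] by auto
        moreover have "Suc (i + m) mod n = i mod n \<longleftrightarrow> n dvd Suc m"
          using mod_eq_dvd_iff_nat[of i "Suc (i + m)" n] by auto
        moreover have "(i + m) mod n = Suc i mod n \<longleftrightarrow> n dvd m - 1"
          using mod_eq_dvd_iff_nat[of "Suc i" "i + m" n] Suc by auto
        ultimately have "n dvd m - 1" "n dvd Suc m" by auto
        then have "n dvd Suc m - (m - 1)" by (metis dvd_diff_nat)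
        then have "n dvd 2" using Suc by simp
        then show False using n by (auto dest: dvd_imp_le)
      qed
      ultimately have "(vs ! ((i + m) mod n), vs ! ((i + Suc m) mod n)) \<in> {(x, y). {x, y} \<in> E}"
        by simp
      then show ?case using Suc by (auto intro: rtrancl_into_rtrancl)
    qed
    from this[of n] have "(vs ! (Suc i mod n), vs ! i) \<in> {(x, y). {x, y} \<in> E}\<^sup>*"
      using n i by simp
    moreover have "vs ! (Suc i mod n) \<in> V" "vs ! i \<in> V" using e uv by (auto simp: doubleton_eq_iff)
    ultimately have "(vs ! (Suc i mod n), vs ! i) \<in> connectivity V E"
      by (simp add: connectivity_def)
    moreover have "sym (connectivity V E)" using equiv_connectivity by (auto simp: equiv_def)
    ultimately show False using e * by (auto simp: doubleton_eq_iff sym_def)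
  qed
  moreover have "is_graph V (insert {u, v} E)"
    using * uv by (auto simp: is_forest_def is_graph_def)
  ultimately show "is_forest V (insert {u, v} E)"
    by (auto simp: is_forest_def)
qed

lemma forest_empty: "is_forest V {}"
  by (auto simp: is_forest_def is_graph_def is_cycle_def intro!: exI[of _ 0])

lemma forest_subset: "is_forest V E \<Longrightarrow> F \<subseteq> E \<Longrightarrow> is_forest V F"
  unfolding is_forest_def is_graph_def is_cycle_def by (meson order_trans subsetD)

lemma components_empty: "components V {} = (\<lambda>v. {v}) ` V"
proof -
  have "{(x, y). {x, y} \<in> ({} :: 'a set set)}\<^sup>* = Id" by simp
  then have "connectivity V {} `` {v} = {v}" if "v \<in> V" for v
    using that unfolding connectivity_def by auto
  then show ?thesis by (auto simp: components_eq quotient_def)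
qed

text \<open>Each edge of a forest joins two distinct components of the edges inserted before it, so
  every insertion lowers their number by one. This yields the exponent of \<open>k\<close>.\<close>

lemma card_components_forest:
  assumes "finite V" "is_forest V E"
  shows "card (components V E) + card E = card V"
proof -
  have "E \<subseteq> Pow V" using assms by (auto simp: is_forest_def is_graph_def)
  then have "finite E" using assms finite_subset by auto
  then show ?thesis using assms(2)
  proof (induction E)
    case empty
    then show ?case by (simp add: components_empty card_image)
  next
    case (insert e E)
    obtain u v where e: "e = {u, v}" "u \<noteq> v" "u \<in> V" "v \<in> V"
      using insert.prems by (auto simp: is_forest_def is_graph_def card_2_iff)
    let ?c = "\<lambda>B. if u \<in> B \<or> v \<in> B then connectivity V E `` {u, v} else B"
    let ?Bu = "connectivity V E `` {u}" and ?Bv = "connectivity V E `` {v}"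
    have uv: "is_forest V E" "(u, v) \<notin> connectivity V E"
      using forest_insert[of u V v E] e insert by auto
    have "?Bu \<noteq> ?Bv" using uv component_self[OF e(4), of E] by auto
    have P: "?Bu \<in> components V E" "?Bv \<in> components V E" using e by (auto intro: component_of)
    \<comment> \<open>\<open>?c\<close> gives \<open>?Bu\<close> and \<open>?Bv\<close> the same
      image and is injective once \<open>?Bv\<close> is removed, so exactly one component is
      lost.\<close>
    have img: "?c ` components V E = ?c ` (components V E - {?Bv})"
    proof -
      have "?c ?Bv = ?c ?Bu" using component_self[OF e(3), of E] component_self[OF e(4), of E] by simp
      moreover have "?Bu \<in> components V E - {?Bv}" using P \<open>?Bu \<noteq> ?Bv\<close> by auto
      ultimately have "?c ?Bv \<in> ?c ` (components V E - {?Bv})" by (rule image_eqI)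
      then have "?c ` insert ?Bv (components V E - {?Bv}) = ?c ` (components V E - {?Bv})"
        unfolding image_insert by (rule insert_absorb)
      then show ?thesis unfolding insert_Diff[OF P(2)] .
    qed
    have "inj_on ?c (components V E - {?Bv})"
    proof (rule inj_onI)
      have *: "v \<notin> B \<and> (u \<in> B \<longleftrightarrow> B = ?Bu)" if "B \<in> components V E - {?Bv}" for B
        using that component_unique[of B V E] component_self[OF e(3), of E] by auto
      have u: "u \<in> connectivity V E `` {u, v}" using component_self[OF e(3), of E] by auto
      fix B C assume BC: "B \<in> components V E - {?Bv}" "C \<in> components V E - {?Bv}" "?c B = ?c C"
      show "B = C"
        using *[OF BC(1)] *[OF BC(2)] BC(3) u by (metis (no_types, lifting))
    qed
    then have "card (components V (insert e E)) = card (components V E - {?Bv})"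
      unfolding e components_insert[OF e(3,4)] img by (rule card_image)
    also have "\<dots> + 1 = card (components V E)"
      using P finite_components[OF assms(1), of E] by (metis Suc_eq_plus1 card_Suc_Diff1)
    finally show ?case using insert uv by simp
  qed
qed

section \<open>Expansion over forests\<close>

text \<open>The components themselves form the ground set, and \<open>f\<close> is evaluated on
  their unions. Contracting an edge then means inserting it into \<open>E\<close>, with
  \<open>f\<close> unchanged.\<close>

definition block_count :: "'v set \<Rightarrow> ('v set \<Rightarrow> int) \<Rightarrow> 'v set set \<Rightarrow> nat" where
  "block_count V f E = card (base_points (components V E) (\<lambda>Q. f (\<Union>Q)))"

lemma submodular_Union_components:
  assumes "submodular V f"
  shows "submodular (components V E) (\<lambda>Q. f (\<Union>Q))"
  unfolding submodular_def
proof (intro conjI allI impI)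
  show "f (\<Union>{}) = 0" using assms by (simp add: submodular_def)
  fix A B assume AB: "A \<subseteq> components V E" "B \<subseteq> components V E"
  have "\<Union>(A \<inter> B) = \<Union>A \<inter> \<Union>B"
    using components_disjoint[of _ V E] AB by blast
  moreover have "\<Union>A \<subseteq> V" "\<Union>B \<subseteq> V"
    using AB Union_components[of V E] by blast+
  ultimately show "f (\<Union>(A \<union> B)) + f (\<Union>(A \<inter> B)) \<le> f (\<Union>A) + f (\<Union>B)"
    using submodularD[OF assms, of "\<Union>A" "\<Union>B"] by simp
qed

text \<open>Seen on the components, an edge becomes an edge between two of them, or a loop if its
  ends are already connected.\<close>

lemma meets_Union_components:
  assumes uv: "u \<in> V" "v \<in> V" and Q: "Q \<subseteq> components V E"
  shows "meets {u, v} (\<Union>Q) = meets {connectivity V E `` {u}, connectivity V E `` {v}} Q"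
proof -
  have "w \<in> \<Union>Q \<longleftrightarrow> connectivity V E `` {w} \<in> Q" if "w \<in> V" for w
  proof
    assume "w \<in> \<Union>Q"
    then obtain B where B: "B \<in> Q" "w \<in> B" by auto
    then have "B = connectivity V E `` {w}" using Q by (intro component_unique) auto
    then show "connectivity V E `` {w} \<in> Q" using B by simp
  next
    assume "connectivity V E `` {w} \<in> Q"
    then show "w \<in> \<Union>Q" using component_self[OF that, of E] by (rule UnionI)
  qed
  from this[OF uv(1)] this[OF uv(2)] show ?thesis
    by (auto simp: meets_def)
qed

text \<open>Deletion-contraction: inside one component the edge is a loop and changes no count;
  otherwise the image under merging the two blocks is the count for
  \<open>insert {u, v} E\<close>.\<close>

lemma block_count_add_edge:
  assumes fin: "finite V" and sub: "submodular V f" and uv: "u \<in> V" "v \<in> V"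
  shows "block_count V (\<lambda>A. f A + meets {u, v} A) E = block_count V f E +
    (if (u, v) \<in> connectivity V E then 0 else block_count V f (insert {u, v} E))"
proof -
  let ?P = "components V E"
  define Bu Bv where "Bu = connectivity V E `` {u}" and "Bv = connectivity V E `` {v}"
  have B: "Bu \<in> ?P" "Bv \<in> ?P" "u \<in> Bu" "v \<in> Bv"
    unfolding Bu_def Bv_def by (intro component_of component_self uv)+
  have finP: "finite ?P" using fin by (rule finite_components)
  have LHS: "block_count V (\<lambda>A. f A + meets {u, v} A) E =
      card (base_points ?P (\<lambda>Q. f (\<Union>Q) + meets {Bu, Bv} Q))"
    unfolding block_count_def Bu_def Bv_def
    by (intro arg_cong[where f = card] base_points_cong) (simp add: meets_Union_components[OF uv])
  show ?thesis
  proof (cases "(u, v) \<in> connectivity V E")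
    case True
    then have "Bu = Bv"
      unfolding Bu_def Bv_def by (rule equiv_class_eq[OF equiv_connectivity])
    then show ?thesis
      unfolding LHS using True card_base_points_add_loop[OF finP B(2)]
      by (simp add: block_count_def)
  next
    case False
    then have ne: "Bu \<noteq> Bv" using B(4) by (auto simp: Bu_def)
    define c where "c = (\<lambda>B. if u \<in> B \<or> v \<in> B then Bu \<union> Bv else B)"
    have "connectivity V E `` {u, v} = Bu \<union> Bv" by (auto simp: Bu_def Bv_def)
    then have cP: "c ` ?P = components V (insert {u, v} E)"
      unfolding c_def components_insert[OF uv] by simp
    have c_eq: "c B = (if B = Bu \<or> B = Bv then Bu \<union> Bv else B)" if "B \<in> ?P" for B
    proof -
      have "u \<in> B \<longleftrightarrow> B = Bu" "v \<in> B \<longleftrightarrow> B = Bv"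
        using that B components_disjoint[of B V E Bu u] components_disjoint[of B V E Bv v] by auto
      then show ?thesis by (simp add: c_def)
    qed
    \<comment> \<open>A component equal to the merged block would contain \<open>u\<close> and so be
      \<open>Bu\<close>. Hence \<open>c\<close> cannot send a third component to the merged
      block.\<close>
    have Bu_not: "B = Bu \<or> B = Bv" if "B \<in> ?P" "B = Bu \<union> Bv" for B
      using that B components_disjoint[of B V E Bu u] by auto
    have "card (base_points ?P (\<lambda>Q. f (\<Union>Q) + meets {Bu, Bv} Q)) =
        card (base_points ?P (\<lambda>Q. f (\<Union>Q))) + card (pushforward c ?P ` base_points ?P (\<lambda>Q. f (\<Union>Q)))"
    proof (rule card_base_points_add_edge[OF finP submodular_Union_components[OF sub] B(1,2) ne])
      show "c Bu = c Bv" using B by (simp add: c_eq)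
      show "C = D \<or> {C, D} = {Bu, Bv}" if "C \<in> ?P" "D \<in> ?P" "c C = c D" for C D
      proof (cases "C = Bu \<or> C = Bv")
        case True
        then have "c D = Bu \<union> Bv" using that c_eq[of C] by simp
        then have "D = Bu \<or> D = Bv" using c_eq[of D] Bu_not[of D] that(2) by metis
        then show ?thesis using True by auto
      next
        case False
        then have "c D = C" using that c_eq[of C] by simp
        moreover have "C \<noteq> Bu \<union> Bv" using Bu_not that(1) False by blast
        ultimately have "D = C" using c_eq[of D] that(2) by metis
        then show ?thesis by simp
      qed
    qed
    also have "pushforward c ?P ` base_points ?P (\<lambda>Q. f (\<Union>Q)) =
        base_points (components V (insert {u, v} E)) (\<lambda>Q. f (\<Union>{B \<in> ?P. c B \<in> Q}))"
      by (rule pushforward_base_points[OF finP submodular_Union_components[OF sub] cP])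
    \<comment> \<open>The selected merged blocks and the old blocks that are sent to them cover the
      same vertices.\<close>
    also have "\<dots> = base_points (components V (insert {u, v} E)) (\<lambda>Q. f (\<Union>Q))"
    proof (intro base_points_cong arg_cong[where f = f] equalityI subsetI)
      fix Q x assume "x \<in> \<Union>{B \<in> ?P. c B \<in> Q}"
      then obtain C where "C \<in> ?P" "c C \<in> Q" "x \<in> C" by auto
      then show "x \<in> \<Union>Q" by (intro UnionI[of "c C"]) (auto simp: c_eq)
    next
      fix Q x assume Q: "Q \<subseteq> components V (insert {u, v} E)" "x \<in> \<Union>Q"
      then obtain D where D: "D \<in> Q" "x \<in> D" by auto
      then obtain C where C: "C \<in> ?P" "D = c C" using Q unfolding cP[symmetric] by auto
      have cB: "c Bu = Bu \<union> Bv" "c Bv = Bu \<union> Bv" using B by (auto simp: c_eq)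
      have "x \<in> C \<or> D = Bu \<union> Bv \<and> (x \<in> Bu \<or> x \<in> Bv)"
        using C D by (auto simp: c_eq split: if_splits)
      then show "x \<in> \<Union>{B \<in> ?P. c B \<in> Q}"
        using C D B cB by auto
    qed
    finally show ?thesis
      unfolding LHS using False by (simp add: block_count_def)
  qed
qed

lemma block_count_add_multiple_edge:
  assumes fin: "finite V" and sub: "submodular V f" and uv: "u \<in> V" "v \<in> V"
  shows "block_count V (\<lambda>A. f A + int k * meets {u, v} A) E = block_count V f E +
    (if (u, v) \<in> connectivity V E then 0 else k * block_count V f (insert {u, v} E))"
proof (induction k)
  case 0
  then show ?case by simp
next
  case (Suc k)
  define g where "g j = (\<lambda>A. f A + int j * meets {u, v} A)" for j
  have sub': "submodular V (g j)" for j
    unfolding g_def by (intro submodular_add submodular_scale submodular_meets sub) simp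
  have gSuc: "g (Suc j) = (\<lambda>A. g j A + meets {u, v} A)" for j
    by (auto simp: g_def algebra_simps)
  have g0: "g 0 = f" by (simp add: g_def)
  have "(u, v) \<in> connectivity V (insert {u, v} E)"
    using connectivity_insert[OF uv] component_self[OF uv(1), of E] component_self[OF uv(2), of E] by auto
  \<comment> \<open>The ends are connected in \<open>insert {u, v} E\<close>, so all copies are
    loops there and each step of the induction on \<open>k\<close> adds the same term.\<close>
  then have "block_count V (g j) (insert {u, v} E) = block_count V f (insert {u, v} E)" for j
    by (induction j) (simp_all add: g0 gSuc block_count_add_edge[OF fin sub' uv])
  then show ?case
    using Suc unfolding g_def[symmetric] by (simp add: gSuc block_count_add_edge[OF fin sub' uv])
qed

text \<open>\<open>X\<close> holds the edges already contracted and \<open>es\<close> those still to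
  be processed. Contraction moves an edge into \<open>X\<close>, hence the induction over arbitrary
  \<open>X\<close>; \<open>Y\<close> records which edges of \<open>es\<close> get
  contracted.\<close>

lemma block_count_forest_expansion:
  assumes fin: "finite V" and sub: "submodular V f"
    and es: "finite es" "es \<subseteq> {e. e \<subseteq> V \<and> card e = 2}"
    and X: "is_forest V X" "X \<inter> es = {}"
  shows "block_count V (\<lambda>A. f A + (\<Sum>e\<in>es. int k * meets e A)) X =
    (\<Sum>Y | Y \<subseteq> es \<and> is_forest V (X \<union> Y). k ^ card Y * block_count V f (X \<union> Y))"
  using es X
proof (induction es arbitrary: X)
  case empty
  have "{Y. Y \<subseteq> {} \<and> is_forest V (X \<union> Y)} = {{}}"
    using empty by auto
  then show ?case by simp
next
  case (insert e es)
  obtain u v where e: "e = {u, v}" "u \<in> V" "v \<in> V" "u \<noteq> v"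
    using insert.prems by (auto simp: card_2_iff)
  define g where "g = (\<lambda>A. f A + (\<Sum>e\<in>es. int k * meets e A))"
  have sub': "submodular V g"
    unfolding g_def by (intro submodular_add submodular_sum submodular_scale submodular_meets sub) simp
  define S where "S X = {Y. Y \<subseteq> es \<and> is_forest V (X \<union> Y)}" for X
  have finS: "finite (S X)" for X
    unfolding S_def by (rule finite_subset[of _ "Pow es"]) (use insert.hyps in auto)
  let ?w = "\<lambda>X Y. k ^ card Y * block_count V f (X \<union> Y)"
  have IH: "block_count V g X = (\<Sum>Y\<in>S X. ?w X Y)" if "is_forest V X" "X \<inter> es = {}" for X
    unfolding g_def S_def using insert that by auto
  have e_notin: "e \<notin> X" using insert.prems by auto
  \<comment> \<open>Sets avoiding \<open>e\<close> belong to deletion; sets containing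
    \<open>e\<close> correspond to sets without it over the enlarged \<open>X\<close>.\<close>
  have split: "{Y. Y \<subseteq> insert e es \<and> is_forest V (X \<union> Y)} = S X \<union> insert e ` S (insert e X)"
  proof (intro equalityI subsetI)
    fix Y assume Y: "Y \<in> {Y. Y \<subseteq> insert e es \<and> is_forest V (X \<union> Y)}"
    show "Y \<in> S X \<union> insert e ` S (insert e X)"
    proof (cases "e \<in> Y")
      case True
      then have "insert e X \<union> (Y - {e}) = X \<union> Y" by auto
      then have "Y - {e} \<in> S (insert e X)" using Y by (auto simp: S_def)
      moreover have "Y = insert e (Y - {e})" using True by auto
      ultimately show ?thesis by (intro UnI2 image_eqI)
    next
      case False
      then show ?thesis using Y by (auto simp: S_def)
    qed
  qed (auto simp: S_def)
  have inj: "inj_on (insert e) (S (insert e X))"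
    using insert.hyps by (auto simp: inj_on_def S_def)
  have disj: "S X \<inter> insert e ` S (insert e X) = {}"
    using insert.hyps by (auto simp: S_def)
  have w_insert: "?w X (insert e Y) = k * ?w (insert e X) Y" if "Y \<in> S (insert e X)" for Y
  proof -
    have "finite Y" "e \<notin> Y" using that insert.hyps by (auto simp: S_def intro: finite_subset)
    then show ?thesis by simp
  qed
  have "(\<Sum>Y | Y \<subseteq> insert e es \<and> is_forest V (X \<union> Y). ?w X Y) =
      (\<Sum>Y\<in>S X. ?w X Y) + (\<Sum>Y\<in>S (insert e X). ?w X (insert e Y))"
    unfolding split using finS disj by (subst sum.union_disjoint) (auto simp: sum.reindex[OF inj])
  also have "(\<Sum>Y\<in>S (insert e X). ?w X (insert e Y)) = k * (\<Sum>Y\<in>S (insert e X). ?w (insert e X) Y)"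
    unfolding sum_distrib_left by (intro sum.cong refl w_insert)
  \<comment> \<open>If \<open>X\<close> already connects the ends of \<open>e\<close>, no forest
    contains \<open>insert e X\<close>, which matches the missing contraction term.\<close>
  also have "k * (\<Sum>Y\<in>S (insert e X). ?w (insert e X) Y) =
      (if (u, v) \<in> connectivity V X then 0 else k * block_count V g (insert e X))"
  proof (cases "(u, v) \<in> connectivity V X")
    case True
    then have "\<not> is_forest V (insert e X)"
      using forest_insert[OF e(2,3,4)] e_notin e(1) by auto
    then have "S (insert e X) = {}"
      unfolding S_def using forest_subset by blast
    then show ?thesis using True by simp
  next
    case False
    then have "is_forest V (insert e X)"
      using forest_insert[OF e(2,3,4)] e_notin e(1) insert.prems by auto
    then show ?thesis using False IH[of "insert e X"] insert by auto
  qed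
  also have "(\<Sum>Y\<in>S X. ?w X Y) = block_count V g X"
    using insert.prems by (intro IH[symmetric]) auto
  also have "block_count V g X + (if (u, v) \<in> connectivity V X then 0 else k * block_count V g (insert e X)) =
      block_count V (\<lambda>A. g A + int k * meets e A) X"
    unfolding e(1) by (rule block_count_add_multiple_edge[OF fin sub' e(2,3), symmetric])
  also have "(\<lambda>A. g A + int k * meets e A) = (\<lambda>A. f A + (\<Sum>e\<in>insert e es. int k * meets e A))"
    using insert.hyps by (auto simp: g_def)
  finally show ?case by simp
qed

section \<open>Rado's theorem for permutohedra\<close>

lemma index_pos_le_iff: "index_pos i \<le> index_pos j \<longleftrightarrow> i \<le> (j :: 'n::{finite,linorder})"
proof
  assume le: "index_pos i \<le> index_pos j"
  show "i \<le> j"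
  proof (rule ccontr)
    assume "\<not> i \<le> j"
    then have "{k. k \<le> j} \<subset> {k. k \<le> i}" by auto
    then have "index_pos j < index_pos i" unfolding index_pos_def by (intro psubset_card_mono) auto
    then show False using le by simp
  qed
qed (auto simp: index_pos_def intro!: card_mono)

lemma bij_index_pos: "bij_betw index_pos (UNIV :: 'n::{finite,linorder} set) {1..CARD('n)}"
proof -
  have inj: "inj (index_pos :: 'n \<Rightarrow> nat)"
    by (rule injI) (metis index_pos_le_iff order_antisym order_refl)
  have "index_pos i \<in> {1..CARD('n)}" for i :: 'n
    unfolding index_pos_def by (auto simp: Suc_le_eq card_gt_0_iff intro!: card_mono)
  then have "range (index_pos :: 'n \<Rightarrow> nat) \<subseteq> {1..CARD('n)}" by auto
  then have "range (index_pos :: 'n \<Rightarrow> nat) = {1..CARD('n)}"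
    by (intro card_subset_eq) (auto simp: card_image[OF inj])
  then show ?thesis using inj by (simp add: bij_betw_def)
qed

definition index_at :: "nat \<Rightarrow> 'n::{finite,linorder}" where
  "index_at = inv_into UNIV index_pos"

lemma index_at_pos [simp]: "index_at (index_pos i) = i"
  unfolding index_at_def using bij_index_pos by (intro inv_into_f_f) (auto simp: bij_betw_def)

lemma index_pos_at [simp]: "v \<in> {1..CARD('n)} \<Longrightarrow> index_pos (index_at v :: 'n::{finite,linorder}) = v"
  unfolding index_at_def using bij_index_pos by (intro f_inv_into_f) (auto simp: bij_betw_def)

lemma bij_index_at: "bij_betw index_at {1..CARD('n)} (UNIV :: 'n::{finite,linorder} set)"
  unfolding index_at_def by (rule bij_betw_inv_into[OF bij_index_pos])

lemma sum_initial_indices: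
  assumes "m \<le> CARD('n)"
  shows "(\<Sum>i | index_pos i \<le> m. h i) = (\<Sum>v\<in>{1..m}. h (index_at v :: 'n::{finite,linorder}))"
proof (rule sum.reindex_bij_betw[symmetric])
  have "inj_on (index_at :: nat \<Rightarrow> 'n) {1..m}"
    using bij_index_at assms by (auto simp: bij_betw_def intro: inj_on_subset)
  moreover have "index_at ` {1..m} = {i :: 'n. index_pos i \<le> m}"
  proof (intro equalityI subsetI)
    fix i :: 'n assume "i \<in> {i. index_pos i \<le> m}"
    then have "index_pos i \<in> {1..m}" using bij_betwE[OF bij_index_pos] by auto
    then show "i \<in> index_at ` {1..m}" by (intro image_eqI[of _ _ "index_pos i"]) auto
  qed (use assms in auto)
  ultimately show "bij_betw index_at {1..m} {i :: 'n. index_pos i \<le> m}" by (simp add: bij_betw_def)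
qed

text \<open>Exchange argument: for the initial segment \<open>T\<close> of size
  \<open>card A\<close>, the sets \<open>A - T\<close> and \<open>T - A\<close> have equal size, and
  the entry \<open>t\<close> at the last position of \<open>T\<close> separates their values. Empty
  \<open>A\<close> has no such position, hence the case split.\<close>

lemma sum_le_initial_sum:
  fixes b :: "real^'n::{finite,linorder}"
  assumes dec: "antimono (\<lambda>i. b $ i)"
  shows "(\<Sum>i\<in>A. b $ i) \<le> (\<Sum>i | index_pos i \<le> card A. b $ i)"
proof (cases "A = {}")
  case True
  have "index_pos i \<ge> 1" for i :: 'n using bij_betwE[OF bij_index_pos] by auto
  then have none: "{i :: 'n. index_pos i \<le> card A} = {}" using True by (simp add: Suc_le_eq)
  show ?thesis unfolding none using True by simp
next
  case False
  define T where "T = {i :: 'n. index_pos i \<le> card A}"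
  have le: "card A \<le> CARD('n)" by (intro card_mono) auto
  have "card T = card A"
    using sum_initial_indices[OF le, of "\<lambda>_. 1 :: nat"] by (simp add: T_def)
  then have card_eq: "card (A - T) = card (T - A)"
    by (simp add: card_Diff_subset_Int Int_commute)
  define t where "t = b $ index_at (card A)"
  have pos: "index_pos (index_at (card A) :: 'n) = card A"
    using False le by (intro index_pos_at) (simp add: Suc_le_eq card_gt_0_iff)
  have "b $ i \<le> t" if "i \<in> A - T" for i
    unfolding t_def using that pos by (intro antimonoD[OF dec]) (simp add: T_def flip: index_pos_le_iff)
  then have "(\<Sum>i\<in>A - T. b $ i) \<le> of_nat (card (A - T)) * t" by (rule sum_bounded_above)
  moreover have "t \<le> b $ i" if "i \<in> T - A" for i
    unfolding t_def using that pos by (intro antimonoD[OF dec]) (simp add: T_def flip: index_pos_le_iff)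
  then have "of_nat (card (T - A)) * t \<le> (\<Sum>i\<in>T - A. b $ i)" by (rule sum_bounded_below)
  ultimately have "(\<Sum>i\<in>A - T. b $ i) \<le> (\<Sum>i\<in>T - A. b $ i)" using card_eq by simp
  moreover have "(\<Sum>i\<in>A. b $ i) = (\<Sum>i\<in>A - T. b $ i) + (\<Sum>i\<in>A \<inter> T. b $ i)"
    by (metis add.commute finite sum.Int_Diff)
  moreover have "(\<Sum>i\<in>T. b $ i) = (\<Sum>i\<in>T - A. b $ i) + (\<Sum>i\<in>A \<inter> T. b $ i)"
    by (metis Int_commute add.commute finite sum.Int_Diff)
  ultimately show ?thesis by (simp add: T_def)
qed

text \<open>Abel summation: lowering the weight of a nonpositive partial sum can only raise the
  product. The full sum stays in the bound; where the lemma is applied, it is 0.\<close>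

lemma abel_sum_le:
  fixes g d :: "nat \<Rightarrow> real"
  assumes "\<And>l. l < m \<Longrightarrow> g (Suc l) \<le> g l" and "\<And>l. l \<le> m \<Longrightarrow> sum d {..<l} \<le> 0"
  shows "(\<Sum>l<Suc m. g l * d l) \<le> g m * sum d {..<Suc m}"
  using assms
proof (induction m)
  case 0
  then show ?case by simp
next
  case (Suc m)
  have "(\<Sum>l<Suc m. g l * d l) \<le> g m * sum d {..<Suc m}"
    using Suc by auto
  also have "\<dots> \<le> g (Suc m) * sum d {..<Suc m}"
    using Suc.prems(1)[of m] Suc.prems(2)[of "Suc m"] by (intro mult_right_mono_neg) auto
  finally show ?case by (simp add: algebra_simps)
qed

lemma ex_sorting_enumeration:
  fixes a :: "'n::finite \<Rightarrow> real"
  obtains q where "bij_betw q {..<CARD('n)} UNIV" "\<And>l. Suc l < CARD('n) \<Longrightarrow> a (q l) \<le> a (q (Suc l))"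
proof -
  obtain xs0 :: "'n list" where xs0: "set xs0 = UNIV" "distinct xs0"
    using finite_distinct_list[of "UNIV :: 'n set"] by auto
  define xs where "xs = sort_key a xs0"
  have xs: "set xs = UNIV" "distinct xs" "sorted (map a xs)" using xs0 by (auto simp: xs_def)
  have len: "length xs = CARD('n)" using xs by (metis distinct_card)
  show thesis
  proof (rule that[of "(!) xs"])
    show "bij_betw ((!) xs) {..<CARD('n)} UNIV"
      using xs len by (intro bij_betw_nth) auto
    show "a (xs ! l) \<le> a (xs ! Suc l)" if "Suc l < CARD('n)" for l
      using sorted_nth_mono[OF xs(3), of l "Suc l"] that len by simp
  qed
qed

text \<open>The bounds hold for permuted vectors and define a convex set. Conversely, a point
  \<open>x\<close> outside the hull would be cut off by a functional \<open>a\<close>, but the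
  permuted vector sorted oppositely to \<open>a\<close> has value at most that of \<open>x\<close>,
  by Abel summation.\<close>

lemma permutohedron_eq:
  fixes b :: "real^'n::{finite,linorder}"
  assumes dec: "antimono (\<lambda>i. b $ i)"
  shows "permutohedron b = {x. (\<Sum>i\<in>UNIV. x $ i) = (\<Sum>i\<in>UNIV. b $ i) \<and>
    (\<forall>A. (\<Sum>i\<in>A. x $ i) \<le> (\<Sum>i | index_pos i \<le> card A. b $ i))}" (is "_ = ?M")
proof
  show "permutohedron b \<subseteq> ?M"
    unfolding permutohedron_def
  proof (rule hull_minimal)
    show "{\<chi> i. b $ p i | p. p permutes UNIV} \<subseteq> ?M"
    proof safe
      fix p :: "'n \<Rightarrow> 'n" assume p: "p permutes UNIV"
      show "(\<Sum>i\<in>UNIV. (\<chi> i. b $ p i) $ i) = (\<Sum>i\<in>UNIV. b $ i)"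
        using sum.permute[OF p, of "\<lambda>i. b $ i"] by (simp add: o_def)
      fix A :: "'n set"
      have inj: "inj_on p A" using permutes_inj[OF p] by (rule inj_on_subset) simp
      have "(\<Sum>i\<in>A. (\<chi> i. b $ p i) $ i) = (\<Sum>i\<in>p ` A. b $ i)"
        by (simp add: sum.reindex[OF inj])
      also have "\<dots> \<le> (\<Sum>i | index_pos i \<le> card A. b $ i)"
        using sum_le_initial_sum[OF dec, of "p ` A"] by (simp add: card_image[OF inj])
      finally show "(\<Sum>i\<in>A. (\<chi> i. b $ p i) $ i) \<le> (\<Sum>i | index_pos i \<le> card A. b $ i)" .
    qed
    show "convex ?M"
    proof (rule convexI)
      fix x y and s t :: real
      assume xy: "x \<in> ?M" "y \<in> ?M" and st: "0 \<le> s" "0 \<le> t" "s + t = 1"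
      have comb: "(\<Sum>i\<in>A. (s *\<^sub>R x + t *\<^sub>R y) $ i) = s * (\<Sum>i\<in>A. x $ i) + t * (\<Sum>i\<in>A. y $ i)" for A
        by (simp add: sum.distrib sum_distrib_left)
      have "(\<Sum>i\<in>UNIV. (s *\<^sub>R x + t *\<^sub>R y) $ i) = (s + t) * (\<Sum>i\<in>UNIV. b $ i)"
        unfolding comb using xy by (simp add: distrib_right)
      moreover have "(\<Sum>i\<in>A. (s *\<^sub>R x + t *\<^sub>R y) $ i) \<le> (s + t) * (\<Sum>i | index_pos i \<le> card A. b $ i)" for A
        unfolding comb distrib_right using xy st by (intro add_mono mult_left_mono) auto
      ultimately show "s *\<^sub>R x + t *\<^sub>R y \<in> ?M" using st by simp
    qed
  qed
  show "?M \<subseteq> permutohedron b"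
  proof (rule subsetI, rule ccontr)
    fix x assume x: "x \<in> ?M" and nx: "x \<notin> permutohedron b"
    let ?H = "{\<chi> i. b $ p i | p. p permutes UNIV}"
    have "?H = (\<lambda>p. \<chi> i. b $ p i) ` {p. p permutes UNIV}" by auto
    then have "finite ?H" using finite_permutations[of "UNIV :: 'n set"] by simp
    then have "closed (permutohedron b)"
      unfolding permutohedron_def by (intro compact_imp_closed finite_imp_compact_convex_hull)
    moreover have "convex (permutohedron b)" by (simp add: permutohedron_def)
    ultimately obtain a d where ad: "inner a x < d" "\<And>y. y \<in> permutohedron b \<Longrightarrow> inner a y > d"
      using separating_hyperplane_closed_point[of "permutohedron b" x] nx by blast
    obtain q where q: "bij_betw q {..<CARD('n)} (UNIV :: 'n set)"
      and mono: "\<And>l. Suc l < CARD('n) \<Longrightarrow> a $ q l \<le> a $ q (Suc l)"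
      using ex_sorting_enumeration[of "\<lambda>i. a $ i"] by blast
    \<comment> \<open>The smallest entry of \<open>a\<close> meets the largest entry of
      \<open>b\<close>, and so on, which makes the inner product minimal. \<open>Suc\<close> is
      there because positions start at 1 and the enumeration \<open>q\<close> at 0.\<close>
    define p :: "'n \<Rightarrow> 'n" where "p = (\<lambda>i. index_at (Suc (inv_into {..<CARD('n)} q i)))"
    have "bij_betw (index_at \<circ> (Suc \<circ> inv_into {..<CARD('n)} q)) UNIV (UNIV :: 'n set)"
    proof (intro bij_betw_trans)
      show "bij_betw (inv_into {..<CARD('n)} q) UNIV {..<CARD('n)}" by (rule bij_betw_inv_into[OF q])
      show "bij_betw Suc {..<CARD('n)} {1..CARD('n)}"
        unfolding bij_betw_def image_Suc_lessThan by simp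
    qed (rule bij_index_at)
    then have "bij p" by (simp add: p_def comp_def)
    then have "p permutes UNIV" by (intro bij_imp_permutes) auto
    then have "(\<chi> i. b $ p i) \<in> permutohedron b"
      unfolding permutohedron_def by (intro hull_inc) auto
    then have less: "inner a x < inner a (\<chi> i. b $ p i)" using ad by fastforce
    have pq: "p (q l) = index_at (Suc l)" if "l < CARD('n)" for l
      using that q by (simp add: p_def bij_betw_def)
    define e where "e l = x $ q l - b $ p (q l)" for l
    have sum_q: "sum h UNIV = (\<Sum>l<CARD('n). h (q l))" for h :: "'n \<Rightarrow> real"
      by (rule sum.reindex_bij_betw[OF q, symmetric])
    have partial: "sum e {..<m} = (\<Sum>i\<in>q ` {..<m}. x $ i) - (\<Sum>i | index_pos i \<le> m. b $ i)"
      if "m \<le> CARD('n)" for m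
    proof -
      have inj: "inj_on q {..<m}" using q that by (auto simp: bij_betw_def intro: inj_on_subset)
      have "(\<Sum>l<m. b $ p (q l)) = (\<Sum>l<m. b $ index_at (Suc l))"
        using that by (intro sum.cong) (auto simp: pq)
      also have "\<dots> = (\<Sum>v\<in>{1..m}. b $ index_at v)"
        by (rule sum.reindex_bij_witness[of _ "\<lambda>v. v - 1" Suc]) auto
      finally show ?thesis
        using sum_initial_indices[OF that, of "\<lambda>i. b $ i"] by (simp add: e_def sum_subtractf sum.reindex[OF inj])
    qed
    have "sum e {..<m} \<le> 0" if "m \<le> CARD('n)" for m
    proof -
      have "card (q ` {..<m}) = m"
        using q that by (subst card_image) (auto simp: bij_betw_def intro: inj_on_subset)
      moreover have "(\<Sum>i\<in>q ` {..<m}. x $ i) \<le> (\<Sum>i | index_pos i \<le> card (q ` {..<m}). b $ i)"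
        using x by blast
      ultimately show ?thesis using partial[OF that] by simp
    qed
    \<comment> \<open>Equality of the totals removes the boundary term of
      \<open>abel_sum_le\<close>.\<close>
    moreover have "sum e {..<CARD('n)} = 0"
      using partial[of "CARD('n)"] x q bij_betwE[OF bij_index_pos[where 'n = 'n]] by (simp add: bij_betw_def)
    moreover obtain m where m: "CARD('n) = Suc m" by (metis card_gt_0_iff finite UNIV_not_empty gr0_implies_Suc)
    ultimately have "(\<Sum>l<CARD('n). - (a $ q l) * e l) \<le> 0"
      using abel_sum_le[of m "\<lambda>l. - (a $ q l)" e] mono by (simp add: m)
    moreover have "inner a x - inner a (\<chi> i. b $ p i) = (\<Sum>l<CARD('n). (a $ q l) * e l)"
      by (simp add: inner_vec_def sum_q e_def sum_subtractf right_diff_distrib)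
    ultimately show False using less by (simp add: sum_negf)
  qed
qed

section \<open>Integer vectors as functions on positions\<close>

definition vec_of :: "(nat \<Rightarrow> int) \<Rightarrow> real^'n::{finite,linorder}" where
  "vec_of x = (\<chi> i. of_int (x (index_pos i)))"

text \<open>\<open>vec_of\<close> forgets the values outside the positions, but members of
  \<open>base_points\<close> are 0 there.\<close>

lemma inj_on_vec_of:
  "inj_on (vec_of :: _ \<Rightarrow> real^'n::{finite,linorder}) (base_points {1..CARD('n)} f)"
proof (rule inj_onI)
  fix x y assume xy: "x \<in> base_points {1..CARD('n)} f" "y \<in> base_points {1..CARD('n)} f"
    and eq: "(vec_of x :: real^'n::{finite,linorder}) = vec_of y"
  show "x = y"
  proof
    fix v
    show "x v = y v"
    proof (cases "v \<in> {1..CARD('n)}")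
      case True
      have "(vec_of x :: real^'n::{finite,linorder}) $ index_at v =
          (vec_of y :: real^'n::{finite,linorder}) $ index_at v" using eq by simp
      then show ?thesis using True by (simp add: vec_of_def)
    qed (use xy base_points_outside in metis)
  qed
qed

lemma sum_vec_of:
  "(\<Sum>i\<in>A. (vec_of x :: real^'n::{finite,linorder}) $ i) = of_int (sum x (index_pos ` A))"
proof -
  have "inj_on (index_pos :: 'n \<Rightarrow> nat) A"
    using bij_index_pos by (auto simp: bij_betw_def intro: inj_on_subset)
  then show ?thesis by (simp add: vec_of_def sum.reindex)
qed

lemma lattice_points_permutohedron:
  assumes dec: "antimono_on {1..CARD('n)} \<beta>"
  shows "lattice_points (permutohedron (vec_of \<beta> :: real^'n::{finite,linorder}))
    = vec_of ` base_points {1..CARD('n)} (\<lambda>A. sum \<beta> {1..card A})"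
proof -
  let ?V = "{1..CARD('n)}" and ?f = "\<lambda>A. sum \<beta> {1..card A}"
  have range: "1 \<le> index_pos i" "index_pos i \<le> CARD('n)" for i :: 'n
    using bij_betwE[OF bij_index_pos] by auto
  have inj: "inj_on (index_pos :: 'n \<Rightarrow> nat) A" for A
    using bij_index_pos by (auto simp: bij_betw_def intro: inj_on_subset)
  have surj: "range (index_pos :: 'n \<Rightarrow> nat) = ?V"
    using bij_index_pos[where 'n = 'n] by (simp add: bij_betw_def)
  have initial: "index_pos ` {i :: 'n. index_pos i \<le> m} = {1..m}" if "m \<le> CARD('n)" for m
  proof -
    have "index_pos ` {i :: 'n. index_pos i \<le> m} = range (index_pos :: 'n \<Rightarrow> nat) \<inter> {..m}" by auto
    then show ?thesis unfolding surj using that by auto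
  qed
  have "antimono (\<lambda>i. (vec_of \<beta> :: real^'n::{finite,linorder}) $ i)"
  proof (rule antimonoI)
    fix i j :: 'n assume "i \<le> j"
    then show "(vec_of \<beta> :: real^'n::{finite,linorder}) $ j \<le> vec_of \<beta> $ i"
      using monotone_onD[OF dec, of "index_pos i" "index_pos j"] range
      by (simp add: vec_of_def index_pos_le_iff)
  qed
  note perm = permutohedron_eq[OF this]
  \<comment> \<open>Sets of indices and sets of positions correspond under \<open>index_pos\<close>,
    which carries one system of inequalities to the other.\<close>
  have mem: "vec_of x \<in> permutohedron (vec_of \<beta> :: real^'n::{finite,linorder}) \<longleftrightarrow> x \<in> base_points ?V ?f"
    if x: "\<And>v. v \<notin> ?V \<Longrightarrow> x v = 0" for x
  proof -
    have "vec_of x \<in> permutohedron (vec_of \<beta> :: real^'n::{finite,linorder}) \<longleftrightarrow>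
        sum x ?V = ?f ?V \<and> (\<forall>A :: 'n set. sum x (index_pos ` A) \<le> ?f (index_pos ` A))"
      unfolding perm mem_Collect_eq sum_vec_of surj
      by (simp only: initial card_mono[OF finite subset_UNIV] card_image[OF inj] of_int_eq_iff of_int_le_iff
          card_atLeastAtMost diff_Suc_1)
    also have "(\<forall>A :: 'n set. sum x (index_pos ` A) \<le> ?f (index_pos ` A)) \<longleftrightarrow> (\<forall>A\<subseteq>?V. sum x A \<le> ?f A)"
      unfolding surj[symmetric] by (metis subset_imageE image_mono subset_UNIV)
    finally show ?thesis using x by (simp add: base_points_def)
  qed
  show ?thesis
  proof (intro equalityI subsetI)
    fix y assume "y \<in> lattice_points (permutohedron (vec_of \<beta> :: real^'n::{finite,linorder}))"
    then have y: "y \<in> permutohedron (vec_of \<beta>)" "\<And>i. y $ i \<in> \<int>" by (auto simp: lattice_points_def)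
    \<comment> \<open>All entries of \<open>y\<close> are integers, so rounding down leaves them as
      they are.\<close>
    define x where "x v = (if v \<in> ?V then \<lfloor>y $ index_at v\<rfloor> else 0)" for v
    have x0: "x v = 0" if "v \<notin> ?V" for v using that by (simp only: x_def if_False)
    have yx: "y = vec_of x"
      using y(2) range by (auto simp: vec_eq_iff vec_of_def x_def Suc_le_eq)
    have "x \<in> base_points ?V ?f"
      using mem[OF x0] y(1) unfolding yx by simp
    with yx show "y \<in> vec_of ` base_points ?V ?f" by blast
  next
    fix y :: "real^'n::{finite,linorder}" assume "y \<in> vec_of ` base_points ?V ?f"
    then obtain x where x: "x \<in> base_points ?V ?f" "y = vec_of x" by blast
    then have "y \<in> permutohedron (vec_of \<beta>)" using mem[OF base_points_outside[OF x(1)]] by simp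
    then show "y \<in> lattice_points (permutohedron (vec_of \<beta>))"
      using x by (simp add: lattice_points_def vec_of_def)
  qed
qed

section \<open>Block sums of a permutohedron\<close>

text \<open>Concavity of the partial sums: moving a window of \<open>s\<close> consecutive entries
  to the right cannot increase its sum.\<close>

lemma antimono_partial_sums_diff:
  fixes \<beta> :: "nat \<Rightarrow> int"
  assumes dec: "antimono_on {1..N} \<beta>" and le: "p \<le> q" "q + s \<le> N"
  shows "sum \<beta> {1..q + s} - sum \<beta> {1..q} \<le> sum \<beta> {1..p + s} - sum \<beta> {1..p}"
proof -
  have diff: "sum \<beta> {1..r + s} - sum \<beta> {1..r} = (\<Sum>t\<in>{1..s}. \<beta> (r + t))" for r
  proof (induction s)
    case (Suc s)
    have "{1..r + Suc s} = insert (r + Suc s) {1..r + s}" by auto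
    then show ?case using Suc by simp
  qed simp
  show ?thesis
    unfolding diff using le by (intro sum_mono monotone_onD[OF dec]) auto
qed

text \<open>The elements of \<open>B - A\<close> add no more on top of \<open>A\<close> than on top
  of \<open>A \<inter> B\<close>, by concavity of the partial sums.\<close>

lemma submodular_concave_card:
  assumes "finite V" "antimono_on {1..card V} \<beta>"
  shows "submodular V (\<lambda>A. sum \<beta> {1..card A})"
  unfolding submodular_def
proof (intro conjI allI impI)
  fix A B assume AB: "A \<subseteq> V" "B \<subseteq> V"
  have fin: "finite A" "finite B" using AB assms(1) finite_subset by auto
  have c: "card (A \<inter> B) \<le> card A" "card (A \<inter> B) \<le> card B" "card (A \<union> B) \<le> card V"
    using AB fin assms(1) by (auto intro!: card_mono)
  have u: "card (A \<union> B) = card A + (card B - card (A \<inter> B))"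
    using card_Un_Int[OF fin] c by simp
  show "sum \<beta> {1..card (A \<union> B)} + sum \<beta> {1..card (A \<inter> B)} \<le> sum \<beta> {1..card A} + sum \<beta> {1..card B}"
    using antimono_partial_sums_diff[OF assms(2) c(1), of "card B - card (A \<inter> B)"] c u by simp
qed simp

text \<open>The element that enlarges \<open>A\<close> to size \<open>m\<close> contributes its
  edges to the \<open>card V - m\<close> vertices still outside. This is the source of the staircase
  added to \<open>a\<close>.\<close>

lemma sum_meets_all_edges:
  assumes fin: "finite V" and A: "A \<subseteq> V"
  shows "(\<Sum>e | e \<subseteq> V \<and> card e = 2. meets e A) = (\<Sum>v\<in>{1..card A}. int (card V) - int v)"
proof -
  have "finite A" using A fin finite_subset by auto
  then show ?thesis using A
  proof (induction A)
    case empty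
    then show ?case by (simp add: meets_def)
  next
    case (insert w A)
    let ?E = "{e. e \<subseteq> V \<and> card e = 2}"
    have finE: "finite ?E" by (rule finite_subset[of _ "Pow V"]) (use fin in auto)
    have new: "{e \<in> ?E. w \<in> e \<and> e \<inter> A = {}} = (\<lambda>z. {w, z}) ` (V - insert w A)"
      using insert by (auto simp: card_2_iff insert_commute)
    have "(\<Sum>e\<in>?E. meets e (insert w A)) = (\<Sum>e\<in>?E. meets e A + of_bool (w \<in> e \<and> e \<inter> A = {}))"
      by (intro sum.cong) (auto simp: meets_def)
    also have "\<dots> = (\<Sum>e\<in>?E. meets e A) + int (card {e \<in> ?E. w \<in> e \<and> e \<inter> A = {}})"
      using finE by (simp add: sum.distrib Int_def)
    also have "card {e \<in> ?E. w \<in> e \<and> e \<inter> A = {}} = card (V - insert w A)"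
      unfolding new by (intro card_image) (auto simp: inj_on_def doubleton_eq_iff)
    also have "int (card (V - insert w A)) = int (card V) - int (card (insert w A))"
      using insert fin card_mono[OF fin insert.prems] by (subst card_Diff_subset) (auto simp: of_nat_diff)
    also have "(\<Sum>e\<in>?E. meets e A) = (\<Sum>v\<in>{1..card A}. int (card V) - int v)"
      using insert by auto
    finally show ?case using insert by simp
  qed
qed

section \<open>Counts that depend only on the sizes of the blocks\<close>

lemma card_base_points_reindex:
  assumes fin: "finite V" and sub: "submodular V f" and c: "bij_betw c V W"
    and fg: "\<And>A. A \<subseteq> V \<Longrightarrow> f A = g (c ` A)"
  shows "card (base_points V f) = card (base_points W g)"
proof -
  have inj: "inj_on c V" and img: "c ` V = W" using c by (auto simp: bij_betw_def)
  have "pushforward c V ` base_points V f = base_points W (\<lambda>Q. f {v \<in> V. c v \<in> Q})"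
    by (rule pushforward_base_points[OF fin sub img])
  also have "\<dots> = base_points W g"
  proof (rule base_points_cong)
    fix Q assume "Q \<subseteq> W"
    then have "c ` {v \<in> V. c v \<in> Q} = Q" using img by auto
    then show "f {v \<in> V. c v \<in> Q} = g Q" using fg[of "{v \<in> V. c v \<in> Q}"] by simp
  qed
  finally have *: "pushforward c V ` base_points V f = base_points W g" .
  have "inj_on (pushforward c V) (base_points V f)"
  proof (intro inj_onI ext)
    fix x y v assume xy: "x \<in> base_points V f" "y \<in> base_points V f" "pushforward c V x = pushforward c V y"
    show "x v = y v"
    proof (cases "v \<in> V")
      case True
      then have "{u \<in> V. c u = c v} = {v}" using inj by (auto simp: inj_on_def)
      then show ?thesis using fun_cong[OF xy(3), of "c v"] by (simp only: pushforward_def) simp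
    qed (use xy(1,2) base_points_outside in metis)
  qed
  from card_image[OF this] show ?thesis unfolding * by simp
qed

text \<open>Common form of two counts: the contraction along a forest with component sizes
  \<open>lam\<close>, and the image under \<open>quot lam\<close>. The ground set consists of the
  positions in the list.\<close>

definition partition_count :: "(nat \<Rightarrow> int) \<Rightarrow> nat list \<Rightarrow> nat" where
  "partition_count \<beta> lam = card (base_points {..<length lam} (\<lambda>Q. sum \<beta> {1..\<Sum>r\<in>Q. lam ! r}))"

lemma component_sizes_list:
  assumes "finite V"
  obtains bs where "distinct bs" "set bs = components V E" "map card bs = component_sizes V E"
proof -
  obtain bs0 where bs0: "set bs0 = components V E" "distinct bs0"
    using finite_distinct_list[OF finite_components[OF assms]] by blast
  define bs where "bs = rev (sort_key card bs0)"
  have "mset (map card (sort_key card bs0)) = image_mset card (mset_set (components V E))"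
    using bs0 by (simp add: mset_set_set[symmetric])
  then have "sort (map card (sort_key card bs0)) = sorted_list_of_multiset (image_mset card (mset_set (components V E)))"
    by (metis sorted_list_of_multiset_mset)
  moreover have "sort (map card (sort_key card bs0)) = map card (sort_key card bs0)"
    by (intro sorted_sort_id sorted_sort_key)
  ultimately have "map card bs = component_sizes V E"
    by (simp add: bs_def component_sizes_def flip: rev_map)
  then show thesis using bs0 by (intro that[of bs]) (auto simp: bs_def)
qed

lemma card_Union_components:
  assumes fin: "finite V" and Q: "Q \<subseteq> components V E"
  shows "card (\<Union>Q) = (\<Sum>B\<in>Q. card B)"
proof (rule card_Union_disjoint)
  show "pairwise disjnt Q"
  proof (rule pairwiseI)
    fix B C assume BC: "B \<in> Q" "C \<in> Q" "B \<noteq> C"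
    then have "B \<in> components V E" "C \<in> components V E" using Q by auto
    then show "disjnt B C" using components_disjoint[of B V E C] BC(3) by (auto simp only: disjnt_iff)
  qed
  show "finite B" if "B \<in> Q" for B
    using that Q by (intro finite_subset[OF components_subset fin]) auto
qed

lemma is_partition_component_sizes:
  assumes "finite V"
  shows "is_partition (component_sizes V E) (card V)"
proof -
  obtain bs where bs: "distinct bs" "set bs = components V E" "map card bs = component_sizes V E"
    using component_sizes_list[OF assms] .
  have "sum_list (component_sizes V E) = (\<Sum>B\<in>components V E. card B)"
    unfolding bs(3)[symmetric] using bs(1,2) by (simp add: sum_list_distinct_conv_sum_set)
  also have "\<dots> = card (\<Union> (components V E))"
    by (rule card_Union_components[OF assms subset_refl, symmetric])
  finally have "sum_list (component_sizes V E) = card V" by (simp add: Union_components)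
  moreover have "\<forall>m\<in>set (component_sizes V E). 0 < m"
    unfolding bs(3)[symmetric] using bs(2) components_nonempty[of V E] components_subset[of _ V E] assms
    by (auto simp: card_gt_0_iff intro: finite_subset)
  moreover have "sorted_wrt (\<ge>) (component_sizes V E)"
    by (simp add: component_sizes_def sorted_wrt_rev)
  ultimately show ?thesis by (simp add: is_partition_def)
qed

lemma length_component_sizes:
  "finite V \<Longrightarrow> length (component_sizes V E) = card (components V E)"
  by (metis component_sizes_list distinct_card length_map)

text \<open>The value on a union of components is determined by their total size, so a bijection
  onto list positions that respects sizes carries one function to the other. \<open>bs\<close> lists
  the components in the order of \<open>component_sizes\<close>.\<close>

lemma block_count_eq_partition_count:
  assumes fin: "finite V" and dec: "antimono_on {1..card V} \<beta>"
  shows "block_count V (\<lambda>A. sum \<beta> {1..card A}) E = partition_count \<beta> (component_sizes V E)"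
proof -
  obtain bs where bs: "distinct bs" "set bs = components V E" "map card bs = component_sizes V E"
    using component_sizes_list[OF fin] .
  define c where "c = inv_into {..<length bs} ((!) bs)"
  have nth: "bij_betw ((!) bs) {..<length bs} (components V E)"
    using bs by (intro bij_betw_nth) auto
  then have c: "bij_betw c (components V E) {..<length bs}"
    unfolding c_def by (rule bij_betw_inv_into)
  have len: "length (component_sizes V E) = length bs" by (simp flip: bs(3))
  show ?thesis
    unfolding block_count_def partition_count_def len
  proof (rule card_base_points_reindex[OF finite_components[OF fin] _ c])
    show "submodular (components V E) (\<lambda>Q. sum \<beta> {1..card (\<Union>Q)})"
      by (rule submodular_Union_components[OF submodular_concave_card[OF fin dec]])
    fix Q assume Q: "Q \<subseteq> components V E"
    have cB: "component_sizes V E ! c B = card B" if "B \<in> Q" for B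
    proof -
      have "c B < length bs" "bs ! c B = B"
        using that Q bij_betwE[OF c] bij_betw_inv_into_right[OF nth, of B] by (auto simp: c_def)
      then show ?thesis by (simp flip: bs(3))
    qed
    have "card (\<Union>Q) = (\<Sum>B\<in>Q. card B)" by (rule card_Union_components[OF fin Q])
    also have "\<dots> = (\<Sum>r\<in>c ` Q. component_sizes V E ! r)"
      using c Q by (subst sum.reindex) (auto simp: bij_betw_def cB intro: inj_on_subset)
    finally show "sum \<beta> {1..card (\<Union>Q)} = sum \<beta> {1..\<Sum>r\<in>c ` Q. component_sizes V E ! r}" by simp
  qed
qed

text \<open>\<open>c\<close> numbers consecutive blocks of lengths \<open>lam\<close> from 0; its
  fibres are the ranges of positions summed in \<open>quot\<close>.\<close>

lemma partition_block:
  assumes "is_partition lam N" "v \<in> {1..N}"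
  defines "c \<equiv> \<lambda>v. LEAST r. v \<le> sum_list (take (Suc r) lam)"
  shows "c v < length lam"
    and "c v = r \<longleftrightarrow> sum_list (take r lam) < v \<and> v \<le> sum_list (take (Suc r) lam)"
proof -
  have total: "sum_list lam = N" using assms by (simp add: is_partition_def)
  have mono: "sum_list (take r lam) \<le> sum_list (take s lam)" if "r \<le> s" for r s
  proof -
    have "take s lam = take r lam @ take (s - r) (drop r lam)" by (metis le_add_diff_inverse take_add that)
    then show ?thesis by simp
  qed
  have ne: "lam \<noteq> []" using total assms(2) by auto
  \<comment> \<open>The last partial sum is \<open>N\<close>, so the \<open>LEAST\<close> ranges
    over a nonempty set.\<close>
  then have *: "v \<le> sum_list (take (Suc (length lam - 1)) lam)" using total assms(2) by simp
  then have "c v \<le> length lam - 1" unfolding c_def by (rule Least_le)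
  then show "c v < length lam" using ne by (cases lam) auto
  show "c v = r \<longleftrightarrow> sum_list (take r lam) < v \<and> v \<le> sum_list (take (Suc r) lam)"
  proof
    assume r: "c v = r"
    have "v \<le> sum_list (take (Suc r) lam)" using LeastI[where P = "\<lambda>r. v \<le> sum_list (take (Suc r) lam)", OF *] r by (simp add: c_def)
    moreover have "sum_list (take r lam) < v"
    proof (cases r)
      case 0
      then show ?thesis using assms(2) by simp
    next
      case (Suc s)
      then have "\<not> v \<le> sum_list (take (Suc s) lam)" using not_less_Least[of s "\<lambda>r. v \<le> sum_list (take (Suc r) lam)"] r by (auto simp: c_def)
      then show ?thesis using Suc by simp
    qed
    ultimately show "sum_list (take r lam) < v \<and> v \<le> sum_list (take (Suc r) lam)" by simp
  next
    assume r: "sum_list (take r lam) < v \<and> v \<le> sum_list (take (Suc r) lam)"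
    show "c v = r" unfolding c_def
    proof (rule Least_equality)
      show "r \<le> s" if "v \<le> sum_list (take (Suc s) lam)" for s
        using mono[of "Suc s" r] that r by (metis leD le_trans not_less_eq_eq)
    qed (use r in simp)
  qed
qed

text \<open>On integer vectors \<open>quot lam\<close> is \<open>pushforward\<close> along the block
  map \<open>c\<close>, so its image is again a full set of base points. Their function only sees
  how many positions the chosen blocks contain.\<close>

lemma card_quot_lattice_points:
  fixes \<beta> :: "nat \<Rightarrow> int"
  assumes part: "is_partition lam CARD('n)" and dec: "antimono_on {1..CARD('n)} \<beta>"
  shows "card (quot lam ` lattice_points (permutohedron (vec_of \<beta> :: real^'n::{finite,linorder})))
    = partition_count \<beta> lam"
proof -
  let ?V = "{1..CARD('n)}" and ?f = "\<lambda>A. sum \<beta> {1..card A}" and ?n = "length lam"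
  define c where "c v = (LEAST r. v \<le> sum_list (take (Suc r) lam))" for v
  note c = partition_block[OF part, folded c_def]
  have total: "sum_list lam = CARD('n)" using part by (simp add: is_partition_def)
  have step: "sum_list (take (Suc r) lam) = sum_list (take r lam) + lam ! r" if "r < ?n" for r
    using that by (simp add: take_Suc_conv_app_nth)
  have upper: "sum_list (take r lam) \<le> CARD('n)" for r
    using sum_list_append[of "take r lam" "drop r lam"] total by simp
  have fibre: "{v \<in> ?V. c v = r} = {sum_list (take r lam) <.. sum_list (take (Suc r) lam)}" for r
  proof (intro equalityI subsetI)
    fix v assume "v \<in> {sum_list (take r lam) <.. sum_list (take (Suc r) lam)}"
    moreover from this have "v \<in> ?V" using upper[of "Suc r"] by auto
    ultimately show "v \<in> {v \<in> ?V. c v = r}" using c(2) by auto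
  qed (use c(2) in auto)
  have card_fibre: "card {v \<in> ?V. c v = r} = lam ! r" if "r < ?n" for r
    unfolding fibre step[OF that] by simp
  have cV: "c ` ?V = {..<?n}"
  proof (intro equalityI subsetI)
    fix r assume "r \<in> {..<?n}"
    \<comment> \<open>Parts are positive, so no block is empty and \<open>c\<close> reaches every
      list position.\<close>
    then have "card {v \<in> ?V. c v = r} > 0"
      using part card_fibre[of r] by (simp add: is_partition_def)
    then show "r \<in> c ` ?V" by (auto simp only: card_gt_0_iff)
  qed (use c(1) in auto)
  have quot_vec: "quot lam (vec_of x :: real^'n::{finite,linorder}) = map (\<lambda>r. of_int (pushforward c ?V x r)) [0..<?n]" for x
  proof -
    have "(\<Sum>i | sum_list (take r lam) < index_pos i \<and> index_pos i \<le> sum_list (take (Suc r) lam).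
        (vec_of x :: real^'n::{finite,linorder}) $ i) = of_int (pushforward c ?V x r)" for r
    proof -
      have "index_pos ` {i :: 'n. sum_list (take r lam) < index_pos i \<and> index_pos i \<le> sum_list (take (Suc r) lam)}
          = range (index_pos :: 'n \<Rightarrow> nat) \<inter> {sum_list (take r lam) <.. sum_list (take (Suc r) lam)}" by auto
      also have "\<dots> = {v \<in> ?V. c v = r}"
        unfolding fibre[symmetric] using bij_index_pos[where 'n = 'n] by (auto simp: bij_betw_def)
      finally show ?thesis unfolding sum_vec_of by (simp add: pushforward_def)
    qed
    then show ?thesis by (simp add: quot_def)
  qed
  \<comment> \<open>\<open>quot\<close> returns lists, so functions are written out up to
    \<open>?n\<close>; base points are 0 from there on.\<close>
  define L where "L y = map (\<lambda>r. real_of_int (y r)) [0..<?n]" for y :: "nat \<Rightarrow> int"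
  have sub: "submodular ?V ?f" using dec by (intro submodular_concave_card) auto
  have "quot lam ` lattice_points (permutohedron (vec_of \<beta> :: real^'n::{finite,linorder})) =
      L ` pushforward c ?V ` base_points ?V ?f"
    unfolding lattice_points_permutohedron[OF dec] image_image quot_vec L_def ..
  also have "pushforward c ?V ` base_points ?V ?f = base_points {..<?n} (\<lambda>Q. ?f {v \<in> ?V. c v \<in> Q})"
    by (rule pushforward_base_points[OF _ sub cV]) simp
  also have "\<dots> = base_points {..<?n} (\<lambda>Q. sum \<beta> {1..\<Sum>r\<in>Q. lam ! r})"
  proof (rule base_points_cong)
    fix Q assume Q: "Q \<subseteq> {..<?n}"
    then have finQ: "finite Q" by (rule finite_subset) simp
    have "{v \<in> ?V. c v \<in> Q} = (\<Union>r\<in>Q. {v \<in> ?V. c v = r})" by auto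
    then have "card {v \<in> ?V. c v \<in> Q} = (\<Sum>r\<in>Q. card {v \<in> ?V. c v = r})"
      using finQ by (simp only:) (intro card_UN_disjoint; auto)
    also have "\<dots> = (\<Sum>r\<in>Q. lam ! r)" using Q by (intro sum.cong card_fibre) auto
    finally show "?f {v \<in> ?V. c v \<in> Q} = sum \<beta> {1..\<Sum>r\<in>Q. lam ! r}" by simp
  qed
  finally have img: "quot lam ` lattice_points (permutohedron (vec_of \<beta> :: real^'n::{finite,linorder})) =
      L ` base_points {..<?n} (\<lambda>Q. sum \<beta> {1..\<Sum>r\<in>Q. lam ! r})" .
  have "inj_on L (base_points {..<?n} g)" for g
  proof (intro inj_onI ext)
    fix x y r assume xy: "x \<in> base_points {..<?n} g" "y \<in> base_points {..<?n} g" "L x = L y"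
    show "x r = y r"
    proof (cases "r < ?n")
      case True
      then show ?thesis using xy(3) by (auto simp: L_def)
    next
      case False
      then show ?thesis
        using base_points_outside[OF xy(1), of r] base_points_outside[OF xy(2), of r] by simp
    qed
  qed
  then show ?thesis unfolding img partition_count_def by (intro card_image)
qed

text \<open>Positive parts bound the length by the sum. Over an infinite set of partitions the sum
  in the formula would be 0 by convention.\<close>

lemma finite_partitions: "finite {lam. is_partition lam m}"
proof (rule finite_subset)
  show "{lam. is_partition lam m} \<subseteq> {xs. set xs \<subseteq> {..m} \<and> length xs \<le> m}"
  proof safe
    fix lam assume lam: "is_partition lam m"
    show "x \<le> m" if "x \<in> set lam" for x
      using member_le_sum_list[OF that] lam by (simp add: is_partition_def)
    have "length lam \<le> sum_list lam" if "\<forall>x\<in>set lam. 0 < x"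
      using that by (induction lam) auto
    then show "length lam \<le> m" using lam by (simp add: is_partition_def)
  qed
qed (intro finite_lists_length_le finite_atMost)

theorem theorem2p16:
  fixes n k :: nat and a :: "int^'n::{finite,linorder}"
  assumes "n \<ge> 1" and "CARD('n) = n + 1"
    and "\<And>i j. i \<le> j \<Longrightarrow> a $ j \<le> a $ i"
  shows "card (lattice_points (permutohedron
             (\<chi> i. of_int (a $ i) + real k * (real (n + 1) - real (index_pos i)))))
       = (\<Sum>lam | is_partition lam (n + 1).
            card (quot lam ` lattice_points (permutohedron (\<chi> i. of_int (a $ i))))
            * num_forests lam * k ^ (n + 1 - length lam))"
proof -
  define V where "V = {1..n + 1}"
  have V: "finite V" "card V = n + 1" by (simp_all add: V_def)
  have V_CARD: "V = {1..CARD('n)}" by (simp add: V_def assms)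
  define \<beta> where "\<beta> v = a $ index_at v" for v
  define \<beta>' where "\<beta>' v = \<beta> v + int k * (int (n + 1) - int v)" for v
  have dec: "antimono_on V \<beta>"
  proof (rule monotone_onI)
    fix u v assume "u \<in> V" "v \<in> V" "u \<le> v"
    then show "\<beta> v \<le> \<beta> u"
      unfolding \<beta>_def using index_pos_at[where 'n = 'n] V_CARD
      by (intro assms(3)) (simp flip: index_pos_le_iff)
  qed
  \<comment> \<open>The added staircase is itself weakly decreasing, so the shifted entries stay
    sorted and \<open>lattice_points_permutohedron\<close> applies to them.\<close>
  have dec': "antimono_on V \<beta>'"
    by (rule monotone_onI) (auto simp: \<beta>'_def intro!: add_mono mult_left_mono monotone_onD[OF dec])
  have vec: "(\<chi> i. of_int (a $ i)) = (vec_of \<beta> :: real^'n::{finite,linorder})"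
    by (simp add: vec_eq_iff vec_of_def \<beta>_def)
  have vec': "(\<chi> i. of_int (a $ i) + real k * (real (n + 1) - real (index_pos i))) =
      (vec_of \<beta>' :: real^'n::{finite,linorder})"
    by (simp add: vec_eq_iff vec_of_def \<beta>_def \<beta>'_def)
  let ?f = "\<lambda>\<beta> A. sum \<beta> {1..card A :: nat} :: int"
  define es where "es = {e. e \<subseteq> V \<and> card e = 2}"
  have sub: "submodular V (?f \<beta>)" "submodular V (?f \<beta>')"
    using dec dec' unfolding V_def by (auto intro!: submodular_concave_card simp del: One_nat_def)
  have es: "finite es"
    unfolding es_def by (rule finite_subset[of _ "Pow V"]) (use V in auto)
  have f': "?f \<beta>' A = ?f \<beta> A + (\<Sum>e\<in>es. int k * meets e A)" if "A \<subseteq> V" for A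
    using sum_meets_all_edges[OF V(1) that] V
    by (simp add: \<beta>'_def es_def sum.distrib flip: sum_distrib_left)
  let ?forests = "{Y. Y \<subseteq> es \<and> is_forest V Y}"
  \<comment> \<open>With no edge contracted the components are singletons, so the expansion can
    start from the empty forest.\<close>
  have "card (base_points V (?f \<beta>')) = block_count V (?f \<beta>') {}"
    unfolding block_count_def
  proof (rule card_base_points_reindex[OF V(1) sub(2)])
    show "bij_betw (\<lambda>v. {v}) V (components V {})"
      by (simp add: components_empty bij_betw_def)
  qed simp
  also have "\<dots> = block_count V (\<lambda>A. ?f \<beta> A + (\<Sum>e\<in>es. int k * meets e A)) {}"
    unfolding block_count_def
    using Union_components[of V "{}"] by (intro arg_cong[where f = card] base_points_cong f') auto
  also have "\<dots> = (\<Sum>Y | Y \<subseteq> es \<and> is_forest V ({} \<union> Y). k ^ card Y * block_count V (?f \<beta>) ({} \<union> Y))"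
    using V es by (intro block_count_forest_expansion sub forest_empty) (auto simp: es_def)
  also have "\<dots> = (\<Sum>Y\<in>?forests. k ^ card Y * block_count V (?f \<beta>) Y)" by simp
  \<comment> \<open>Forests are grouped by their component sizes, which always form a partition of
    \<open>n + 1\<close>.\<close>
  also have "\<dots> = (\<Sum>lam | is_partition lam (n + 1). \<Sum>Y | Y \<in> ?forests \<and> component_sizes V Y = lam.
      k ^ card Y * block_count V (?f \<beta>) Y)"
    using es is_partition_component_sizes[OF V(1)] V(2)
    by (intro sum.group[symmetric] finite_partitions) auto
  also have "\<dots> = (\<Sum>lam | is_partition lam (n + 1).
      partition_count \<beta> lam * num_forests lam * k ^ (n + 1 - length lam))"
  proof (rule sum.cong[OF refl])
    fix lam assume "lam \<in> {lam. is_partition lam (n + 1)}"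
    then have lam: "is_partition lam (n + 1)" by simp
    have "k ^ card Y * block_count V (?f \<beta>) Y = k ^ (n + 1 - length lam) * partition_count \<beta> lam"
      if "is_forest V Y" "component_sizes V Y = lam" for Y
    proof -
      have "card Y = n + 1 - length lam"
        using card_components_forest[OF V(1) that(1)] length_component_sizes[OF V(1), of Y] that(2) V(2) by simp
      moreover have "block_count V (?f \<beta>) Y = partition_count \<beta> lam"
        using block_count_eq_partition_count[OF V(1), of \<beta> Y] dec that(2) by (simp add: V_def)
      ultimately show ?thesis by simp
    qed
    then have "(\<Sum>Y | Y \<in> ?forests \<and> component_sizes V Y = lam. k ^ card Y * block_count V (?f \<beta>) Y) =
        card {Y \<in> ?forests. component_sizes V Y = lam} * (k ^ (n + 1 - length lam) * partition_count \<beta> lam)"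
      by simp
    \<comment> \<open>A forest on \<open>V\<close> has all its edges in \<open>es\<close>, so these
      are the sets counted by \<open>num_forests\<close>.\<close>
    moreover have "{Y \<in> ?forests. component_sizes V Y = lam} = {Y. is_forest V Y \<and> component_sizes V Y = lam}"
      by (auto simp: es_def is_forest_def is_graph_def)
    moreover have "V = {1..sum_list lam}" using lam by (simp add: V_def is_partition_def)
    ultimately show "(\<Sum>Y | Y \<in> ?forests \<and> component_sizes V Y = lam. k ^ card Y * block_count V (?f \<beta>) Y) =
        partition_count \<beta> lam * num_forests lam * k ^ (n + 1 - length lam)"
      by (simp add: num_forests_def)
  qed
  also have "\<dots> = (\<Sum>lam | is_partition lam (n + 1).
            card (quot lam ` lattice_points (permutohedron (vec_of \<beta> :: real^'n::{finite,linorder})))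
            * num_forests lam * k ^ (n + 1 - length lam))"
    using card_quot_lattice_points[where 'n = 'n] dec
    by (intro sum.cong refl) (simp add: V_CARD assms(2))
  finally show ?thesis
    unfolding vec vec' lattice_points_permutohedron[OF dec'[unfolded V_CARD]]
      card_image[OF inj_on_vec_of] V_CARD .
qed

end
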